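(* Let $T>0$, let $\lambda<0$, and let $g\in C(\mathbb{R})$ be a real-valued $T$-periodic function such that $0<g_{min}\le g(x)\le g_{max}$ for all $x\in\mathbb{R}$, where $g_{min},g_{max}$ are constants. Consider the equation $$-\frac12\phi_{xx}+\lambda\phi+g(x)\phi^3=0,\qquad x\in\mathbb{R}. \qquad ( * )$$ Let $\phi_+$ be a $T$-periodic solution of $( * )$ satisfying $$\sqrt{-\frac{\lambda}{g_{max}}}<\phi_+(x)<\sqrt{-\frac{\lambda}{g_{min}}}\quad\text{for all }x\in\mathbb{R},$$ and set $\phi_-=-\phi_+$. Then $( * )$ admits a solution $\phi$ such that $$\frac{\phi(x)}{\phi_+(x)}\to 1\ \text{ as } x\to+\infty,\qquad \frac{\phi(x)}{\phi_-(x)}\to 1\ \text{ as } x\to-\infty.$$ Moreover, it holds that $$\left(\frac{\phi}{\phi_+}\right)_x>0,\qquad x\in\mathbb{R},$$ and there exists a constant $C_0>0$ such that $$|\phi(x)-\phi_+(x)|+|(\phi(x)-\phi_+(x))_x|\le e^{-C_0|x|}\quad\text{for all }x>0,$$ $$|\phi(x)-\phi_-(x)|+|(\phi(x)-\phi_-(x))_x|\le e^{-C_0|x|}\quad\text{for all }x<0.$$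
   Context: Solutions of $( * )$ are real-valued functions on $\mathbb{R}$; subscripts $x$ denote derivatives. The constants $\sqrt{-\lambda/g_{max}}$ and $\sqrt{-\lambda/g_{min}}$ are $T$-periodic lower and upper solutions of $( * )$, respectively, and the existence of a $T$-periodic solution $\phi_+$ with the stated bounds is obtained from the classical method of upper and lower solutions; this $\phi_+$ is fixed throughout. Since $( * )$ is odd in $\phi$, $\phi_-=-\phi_+$ is also a $T$-periodic solution. Equation $( * )$ is the equation for the profile of solitary waves $\psi(x,t)=e^{i\lambda t}\phi(x)$ of the defocusing cubic nonlinear Schrödinger equation $i\psi_t=-\frac12\psi_{xx}+g(x)|\psi|^2\psi$; such a wave is called a dark soliton when $\phi$ is asymptotic, in the stated sense of quotients tending to $1$, to sign definite $T$-periodic solutions $\phi_\pm$ of $( * )$ as $x\to\pm\infty$.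
   Formalization: The exponential bounds are stated with a prefactor C > 0, as C e^{-C_0|x|}; with prefactor 1 for all x they fail, e.g. g = 1, λ = -9, φ_+ = 3, where x → 0 would force |φ(0)-3| ≤ 1 and |φ(0)+3| ≤ 1. *)

theory Defs
  imports "HOL-Analysis.Analysis" "HOL-Library.Periodic_Fun"
begin

(* Classical solutions on the whole line of
     - (1/2) phi_xx + lam phi + g phi^3 = 0.
   Because deriv is a total operator, twofold differentiability is required explicitly.
   For continuous g the second derivative is then continuous, so this is the same as
   asking for a C^2 solution. *)
definition profile_solution :: "real \<Rightarrow> (real \<Rightarrow> real) \<Rightarrow> (real \<Rightarrow> real) \<Rightarrow> bool" where
  "profile_solution lam g \<phi> \<longleftrightarrow>
     (\<forall>x. \<phi> differentiable (at x) \<and> deriv \<phi> differentiable (at x) \<and>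
          - (1 / 2) * deriv (deriv \<phi>) x + lam * \<phi> x + g x * \<phi> x ^ 3 = 0)"

(* |u(x)| + |u_x(x)| <= C exp (- C0 |x|) on S.
   The prefactor C cannot be normalised to 1 for a bound on a full half-line: for g = 1,
   lam = -9 and phi_+ = 3, prefactor 1 would force phi(0) >= 2 (from x > 0) and
   phi(0) <= -2 (from x < 0). *)
definition exp_decay_C1_on :: "real set \<Rightarrow> real \<Rightarrow> real \<Rightarrow> (real \<Rightarrow> real) \<Rightarrow> bool" where
  "exp_decay_C1_on S C C0 u \<longleftrightarrow> (\<forall>x\<in>S. \<bar>u x\<bar> + \<bar>deriv u x\<bar> \<le> C * exp (- C0 * \<bar>x\<bar>))"

end

theory Submission
  imports Defs
begin

text \<open>
Write \<open>\<phi> = \<phi>\<^sub>+ u\<close>. The profile equation becomes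
\<open>(\<phi>\<^sub>+\<^sup>2 u')' = 2 g \<phi>\<^sub>+\<^sup>4 (u\<^sup>3 - u)\<close>, and in the variable \<open>\<sigma> = \<integral> dx / \<phi>\<^sub>+\<^sup>2\<close> it reads
\<open>U'' = h (U\<^sup>3 - U)\<close> with a continuous, positive, periodic coefficient \<open>h\<close>. The dark soliton is an
increasing heteroclinic solution of this equation from \<open>-1\<close> to \<open>1\<close>.

For every position \<open>s\<close> there is a solution on \<open>[s, \<infinity>)\<close> that vanishes at \<open>s\<close> and increases to \<open>1\<close> (a
half-line kink, found by shooting in \<open>kink_exists\<close>), and by reflection one on \<open>(-\<infinity>, s]\<close> that comes
from \<open>-1\<close>. Glued together they solve the equation except for a possible corner at \<open>s\<close>. For a general
coefficient the corner cannot be removed: if \<open>h\<close> is strictly monotone, no heteroclinic exists, because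
the energy \<open>U'\<^sup>2/2 - h (1 - U\<^sup>2)\<^sup>2/4\<close> is then strictly monotone and vanishes at both ends. Periodicity has to
enter, and it does so through compactness: the position \<open>s\<close> may be restricted to one period, and is
chosen so as to minimise the total action \<open>\<integral> U'\<^sup>2/2 + h (1 - U\<^sup>2)\<^sup>2/4\<close> of the glued function.

At a minimising position there is no corner. Replacing the function near \<open>s\<close> by a chord of half-width
\<open>\<delta>\<close> would save an action of order \<open>\<delta>\<close> times the squared jump of the derivative and cost
only \<open>O(\<delta>\<^sup>3)\<close> in the potential. The competitor is not a solution, but it vanishes at some other position
\<open>r\<close>, and half-line kinks minimise the action among all functions with the same zero. This minimality
(\<open>kink_comparison\<close>) comes from a hidden convexity: the action density is convex as a function of the
square of the unknown, which Picone's identity turns into a calibration. Together this is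
\<open>corner_estimate\<close>. The minimum itself need not be attained a priori: kinks along a minimising sequence of positions
converge by continuous dependence on initial data, and the corner estimate passes to the limit
(\<open>matching_kinks_exist\<close>).

The exponential rates come from the two energies \<open>U'\<^sup>2/2 - c (1 - U\<^sup>2)\<^sup>2/4\<close>, with \<open>c\<close> the lower and the
upper bound of \<open>h\<close>: they are monotone along a kink and vanish at infinity, so that \<open>U'\<close> is
comparable to \<open>1 - U\<^sup>2\<close>.
\<close>

section \<open>Antiderivatives and monotonicity\<close>

lemma real_antiderivative_exists:
  fixes f :: "real \<Rightarrow> real"
  assumes "continuous_on UNIV f"
  obtains G where "\<And>x. (G has_real_derivative f x) (at x)"
proof -
  have "\<exists>F. \<forall>x::real. - \<infinity> < ereal x \<longrightarrow> ereal x < \<infinity> \<longrightarrow> (F has_vector_derivative f x) (at x)"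
    by (rule einterval_antiderivative)
      (use assms in \<open>auto simp: continuous_on_eq_continuous_at\<close>)
  then show thesis
    using that by (auto simp: has_real_derivative_iff_has_vector_derivative)
qed

lemma integral_antiderivative:
  fixes G :: "real \<Rightarrow> real"
  assumes "\<And>x. (G has_real_derivative y x) (at x)"
  shows "integral {0..t} y = G (max 0 t) - G 0"
proof (cases "0 \<le> t")
  case True
  have "(y has_integral (G t - G 0)) {0..t}"
    by (rule fundamental_theorem_of_calculus[OF True])
      (use assms in \<open>auto simp: has_real_derivative_iff_has_vector_derivative
        intro: has_vector_derivative_at_within\<close>)
  with True show ?thesis by (simp add: integral_unique max_def)
qed auto

lemma le_of_deriv_nonneg:
  fixes F :: "real \<Rightarrow> real"
  assumes "\<And>x. a \<le> x \<Longrightarrow> x \<le> b \<Longrightarrow> (F has_real_derivative F' x) (at x)"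
    and "\<And>x. a \<le> x \<Longrightarrow> x \<le> b \<Longrightarrow> 0 \<le> F' x" and "a \<le> b"
  shows "F a \<le> F b"
  using DERIV_nonneg_imp_nondecreasing[of a b F] assms by blast

section \<open>The initial value problem for the clamped cubic\<close>

text \<open>The nonlinearity is cut off at both zeros \<open>0\<close> and \<open>1\<close>. It is then bounded and globally Lipschitz, so
all trajectories are global, and it is nonpositive everywhere, so all trajectories are concave: one that leaves
\<open>[0, 1]\<close> does so for good and along a straight line, which is what the shooting argument needs.\<close>

definition clamped_cubic :: "real \<Rightarrow> real" where
  "clamped_cubic x = (max 0 (min 1 x))^3 - max 0 (min 1 x)"

lemma clamped_cubic_eq: "0 \<le> x \<Longrightarrow> x \<le> 1 \<Longrightarrow> clamped_cubic x = x^3 - x"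
  and clamped_cubic_nonpos [simp]: "x \<le> 0 \<Longrightarrow> clamped_cubic x = 0"
  and clamped_cubic_ge1 [simp]: "1 \<le> x \<Longrightarrow> clamped_cubic x = 0"
  by (auto simp: clamped_cubic_def)

lemma clamped_cubic_bounds: "clamped_cubic x \<le> 0" "\<bar>clamped_cubic x\<bar> \<le> 1"
proof -
  define c where "c = max 0 (min 1 x)"
  have c: "0 \<le> c" "c \<le> 1" by (auto simp: c_def)
  have "c^3 \<le> c" using power_decreasing[of 1 3 c] c by simp
  moreover have "0 \<le> c^3" using c by simp
  ultimately show "clamped_cubic x \<le> 0" "\<bar>clamped_cubic x\<bar> \<le> 1"
    using c unfolding clamped_cubic_def c_def[symmetric] by - linarith+
qed

lemma clamped_cubic_lipschitz: "\<bar>clamped_cubic x - clamped_cubic y\<bar> \<le> 2 * \<bar>x - y\<bar>"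
proof -
  define c d where "c = max 0 (min 1 x)" and "d = max 0 (min 1 y)"
  have c: "0 \<le> c" "c \<le> 1" "0 \<le> d" "d \<le> 1" by (auto simp: c_def d_def)
  have "\<bar>c - d\<bar> \<le> \<bar>x - y\<bar>" by (auto simp: c_def d_def)
  moreover have "\<bar>c^2 + c*d + d^2 - 1\<bar> \<le> 2"
  proof -
    have "c^2 \<le> 1" "d^2 \<le> 1" "c*d \<le> 1" "0 \<le> c*d"
      using c by (auto simp: power_le_one mult_le_one)
    thus ?thesis using zero_le_power2[of c] zero_le_power2[of d] by linarith
  qed
  ultimately have "\<bar>c^2 + c*d + d^2 - 1\<bar> * \<bar>c - d\<bar> \<le> 2 * \<bar>x - y\<bar>"
    by (intro mult_mono) auto
  moreover have "clamped_cubic x - clamped_cubic y = (c^2 + c*d + d^2 - 1) * (c - d)"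
    unfolding clamped_cubic_def c_def[symmetric] d_def[symmetric] by algebra
  ultimately show ?thesis by (simp add: abs_mult)
qed

lemma continuous_on_clamped_cubic [continuous_intros]:
  "continuous_on S f \<Longrightarrow> continuous_on S (\<lambda>x. clamped_cubic (f x))"
  unfolding clamped_cubic_def by (intro continuous_intros)

text \<open>The double integration \<open>y \<mapsto> \<integral>\<^sub>0\<^sup>t (t - r) y r dr\<close> has norm at most \<open>1/K\<^sup>2\<close> with respect to the
weight \<open>exp (- K t)\<close>. A large \<open>K\<close> therefore makes the Picard iteration a contraction on the whole half-line at once.\<close>

lemma exp_weighted_integral_bound:
  fixes y :: "real \<Rightarrow> real"
  assumes "0 < K" "0 \<le> D" "continuous_on UNIV y"
    and y: "\<And>r. 0 \<le> r \<Longrightarrow> \<bar>y r\<bar> \<le> D * exp (K * r)"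
  shows "\<bar>exp (- K * t) * integral {0..t} (\<lambda>r. (t - r) * y r)\<bar> \<le> D / K^2"
proof (cases "0 \<le> t")
  case True
  define P where "P r = D * ((t - r) * exp (K * r) / K + exp (K * r) / K^2)" for r
  have "((\<lambda>r. D * ((t - r) * exp (K * r))) has_integral (P t - P 0)) {0..t}"
  proof (rule fundamental_theorem_of_calculus[OF True])
    fix x
    have "(P has_real_derivative D * ((t - x) * exp (K * x))) (at x)"
      unfolding P_def using \<open>0 < K\<close>
      by (auto intro!: derivative_eq_intros simp: field_simps power2_eq_square)
    thus "(P has_vector_derivative D * ((t - x) * exp (K * x))) (at x within {0..t})"
      by (simp add: has_real_derivative_iff_has_vector_derivative has_vector_derivative_at_within)
  qed
  hence int: "integral {0..t} (\<lambda>r. D * ((t - r) * exp (K * r))) = P t - P 0"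
    "(\<lambda>r. D * ((t - r) * exp (K * r))) integrable_on {0..t}"
    by (rule integral_unique, rule has_integral_integrable)
  have "norm (integral {0..t} (\<lambda>r. (t - r) * y r))
      \<le> integral {0..t} (\<lambda>r. D * ((t - r) * exp (K * r)))"
  proof (rule integral_norm_bound_integral)
    show "(\<lambda>r. (t - r) * y r) integrable_on {0..t}"
      by (intro integrable_continuous_interval continuous_intros
          continuous_on_subset[OF assms(3)]) auto
    show "(\<lambda>r. D * ((t - r) * exp (K * r))) integrable_on {0..t}" by (rule int)
    fix r assume "r \<in> {0..t}"
    hence "(t - r) * \<bar>y r\<bar> \<le> (t - r) * (D * exp (K * r))"
      using y by (intro mult_left_mono) auto
    thus "norm ((t - r) * y r) \<le> D * ((t - r) * exp (K * r))"
      using \<open>r \<in> {0..t}\<close> by (auto simp: abs_mult mult_ac)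
  qed
  also have "\<dots> = P t - P 0" by (rule int)
  also have "\<dots> \<le> P t"
    using True assms by (simp add: P_def)
  also have "P t = D / K^2 * exp (K * t)" by (simp add: P_def)
  finally have "exp (- K * t) * \<bar>integral {0..t} (\<lambda>r. (t - r) * y r)\<bar>
      \<le> exp (- K * t) * (D / K^2 * exp (K * t))"
    by (intro mult_left_mono) auto
  also have "\<dots> = D / K^2" by (simp add: exp_minus field_simps)
  finally show ?thesis by (simp add: abs_mult)
next
  case False
  thus ?thesis using assms by simp
qed

text \<open>Banach's fixed point theorem for the weighted remainder \<open>w = exp (- K t) (u - m t)\<close>. The equation holds for all
real times although it is solved on the half-line only: the slope \<open>m\<close> is nonnegative, so \<open>m t\<close> solves the clamped
equation for \<open>t \<le> 0\<close>. Derivatives at \<open>0\<close> are thus two-sided.\<close>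

lemma clamped_ivp_exists:
  fixes h :: "real \<Rightarrow> real"
  assumes h: "continuous_on UNIV h" and H: "\<And>t. \<bar>h t\<bar> \<le> H" and "0 < H" and m: "0 \<le> m"
  obtains u v where "u 0 = 0" "v 0 = m"
    "\<And>t. (u has_real_derivative v t) (at t)"
    "\<And>t. (v has_real_derivative h t * clamped_cubic (u t)) (at t)"
proof -
  define K where "K = 2 * sqrt H"
  have K: "0 < K" "K^2 = 4 * H" using \<open>0 < H\<close> by (auto simp: K_def power_mult_distrib)
  define y where "y w r = h r * clamped_cubic (m * r + exp (K * r) * w r)" for r :: real and w :: "real \<Rightarrow> real"
  define I where "I w t = exp (- K * t) * integral {0..t} (\<lambda>r. (t - r) * y w r)"
    for t :: real and w :: "real \<Rightarrow> real"
  have y_cont: "continuous_on UNIV (y w)" if "continuous_on UNIV w" for w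
    unfolding y_def by (intro continuous_intros h that)
  have I_cont: "continuous_on UNIV (I w)" if w: "continuous_on UNIV w" for w
  proof -
    obtain G1 where G1: "\<And>x. (G1 has_real_derivative y w x) (at x)"
      using real_antiderivative_exists[OF y_cont[OF w]] by blast
    have "continuous_on UNIV (\<lambda>r. r * y w r)" by (intro continuous_intros y_cont w)
    then obtain G2 where G2: "\<And>x. (G2 has_real_derivative x * y w x) (at x)"
      using real_antiderivative_exists by blast
    have "integral {0..t} (\<lambda>r. (t - r) * y w r)
        = t * (G1 (max 0 t) - G1 0) - (G2 (max 0 t) - G2 0)" for t
      by (subst integral_antiderivative[where G = "\<lambda>x. t * G1 x - G2 x"])
        (auto intro!: derivative_eq_intros G1 G2 simp: algebra_simps)
    hence "I w = (\<lambda>t. exp (- K * t) * (t * (G1 (max 0 t) - G1 0) - (G2 (max 0 t) - G2 0)))"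
      by (auto simp: I_def)
    moreover have "continuous_on UNIV G1" "continuous_on UNIV G2"
      using G1 G2 by (meson DERIV_isCont continuous_at_imp_continuous_on)+
    hence "continuous_on UNIV (\<lambda>t. G1 (max 0 t))" "continuous_on UNIV (\<lambda>t. G2 (max 0 t))"
      by - (rule continuous_on_compose2[of UNIV _ UNIV]; (intro continuous_intros)?; simp)+
    ultimately show ?thesis by (auto intro!: continuous_intros)
  qed
  have I_bound: "\<bar>I w t\<bar> \<le> H / K^2" if w: "continuous_on UNIV w" for w t
    unfolding I_def
  proof (rule exp_weighted_integral_bound)
    fix r :: real assume "0 \<le> r"
    have "\<bar>y w r\<bar> \<le> H * 1" unfolding y_def abs_mult
      by (intro mult_mono H clamped_cubic_bounds) (use \<open>0 < H\<close> in auto)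
    also have "\<dots> \<le> H * exp (K * r)" using \<open>0 \<le> r\<close> K \<open>0 < H\<close> by (intro mult_left_mono) auto
    finally show "\<bar>y w r\<bar> \<le> H * exp (K * r)" .
  qed (use K \<open>0 < H\<close> y_cont w in auto)
  have I_bcont: "I w \<in> bcontfun" if "continuous_on UNIV w" for w
    by (rule bcontfun_normI[OF I_cont[OF that]]) (use I_bound[OF that] in auto)
  define \<Phi> :: "(real \<Rightarrow>\<^sub>C real) \<Rightarrow> (real \<Rightarrow>\<^sub>C real)" where "\<Phi> w = Bcontfun (I w)" for w
  have wc: "continuous_on UNIV w" for w :: "real \<Rightarrow>\<^sub>C real"
    using apply_bcontfun[of w] by (auto simp: bcontfun_def)
  have \<Phi>: "apply_bcontfun (\<Phi> w) t = I w t" for w t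
    using I_bcont[OF wc] by (simp add: \<Phi>_def Bcontfun_inverse)
  have I_lip: "\<bar>I w t - I z t\<bar> \<le> 1/2 * dist w z" for w z :: "real \<Rightarrow>\<^sub>C real" and t
  proof -
    have "(\<lambda>r. (t - r) * y w r) integrable_on {0..t}" for w :: "real \<Rightarrow>\<^sub>C real"
      by (intro integrable_continuous_interval continuous_intros
          continuous_on_subset[OF y_cont[OF wc]]) auto
    note int = integral_diff[OF this[of w] this[of z]]
    have "(\<lambda>r. (t - r) * (y w r - y z r)) = (\<lambda>r. (t - r) * y w r - (t - r) * y z r)"
      by (simp add: right_diff_distrib)
    hence "I w t - I z t = exp (- K * t) * integral {0..t} (\<lambda>r. (t - r) * (y w r - y z r))"
      unfolding I_def by (simp only: int right_diff_distrib[of "exp _"])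
    also have "\<bar>\<dots>\<bar> \<le> (2 * H * dist w z) / K^2"
    proof (rule exp_weighted_integral_bound)
      fix r :: real assume "0 \<le> r"
      have "\<bar>y w r - y z r\<bar> = \<bar>h r\<bar> * \<bar>clamped_cubic (m * r + exp (K * r) * w r)
          - clamped_cubic (m * r + exp (K * r) * z r)\<bar>"
        by (simp add: y_def abs_mult[symmetric] algebra_simps)
      also have "\<dots> \<le> H * (2 * \<bar>exp (K * r) * w r - exp (K * r) * z r\<bar>)"
        by (rule mult_mono[OF H order.trans[OF clamped_cubic_lipschitz]]) (use \<open>0 < H\<close> in auto)
      also have "\<bar>exp (K * r) * w r - exp (K * r) * z r\<bar> = exp (K * r) * dist (w r) (z r)"
        by (simp add: dist_real_def abs_mult right_diff_distrib[symmetric])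
      also have "\<dots> \<le> exp (K * r) * dist w z"
        by (intro mult_left_mono dist_bounded) auto
      finally show "\<bar>y w r - y z r\<bar> \<le> 2 * H * dist w z * exp (K * r)"
        using \<open>0 < H\<close> by (simp add: mult_ac)
    next
      show "continuous_on UNIV (\<lambda>r. y w r - y z r)" by (intro continuous_on_diff y_cont wc)
    qed (use K \<open>0 < H\<close> in auto)
    also have "\<dots> = 1/2 * dist w z" using K \<open>0 < H\<close> by simp
    finally show ?thesis .
  qed
  have "\<exists>!w. \<Phi> w = w"
  proof (rule banach_fix_type)
    show "\<forall>w z. dist (\<Phi> w) (\<Phi> z) \<le> 1/2 * dist w z"
      by (intro allI dist_bound) (use I_lip in \<open>auto simp: \<Phi> dist_real_def\<close>)
  qed auto
  then obtain w where "\<Phi> w = w" by auto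
  hence w: "w t = I w t" for t using \<Phi>[of w t] by simp
  obtain G1 where G1: "\<And>x. (G1 has_real_derivative y w x) (at x)"
    using real_antiderivative_exists[OF y_cont[OF wc]] by blast
  have "continuous_on UNIV (\<lambda>r. r * y w r)" by (intro continuous_intros y_cont wc)
  then obtain G2 where G2: "\<And>x. (G2 has_real_derivative x * y w x) (at x)"
    using real_antiderivative_exists by blast
  define u where "u t = m * t + exp (K * t) * w t" for t
  have yu: "y w t = h t * clamped_cubic (u t)" for t by (simp add: y_def u_def)
  have u_eq: "u t = m * t + (t * (G1 (max 0 t) - G1 0) - (G2 (max 0 t) - G2 0))" for t
  proof -
    have "integral {0..t} (\<lambda>r. (t - r) * y w r)
        = t * (G1 (max 0 t) - G1 0) - (G2 (max 0 t) - G2 0)"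
      by (subst integral_antiderivative[where G = "\<lambda>x. t * G1 x - G2 x"])
        (auto intro!: derivative_eq_intros G1 G2 simp: algebra_simps)
    thus ?thesis unfolding u_def w[of t] I_def by (simp add: exp_minus field_simps)
  qed
  \<comment> \<open>The forcing vanishes for negative times, where \<open>u\<close> is the nonpositive function \<open>m * t\<close>;
      hence the antiderivatives are constant there and all derivatives are two-sided.\<close>
  have y_neg: "y w t = 0" if "t \<le> 0" for t
    using that m u_eq[of t] by (simp add: yu mult_nonneg_nonpos max_def split: if_splits)
  have const: "G (max 0 t) = G t"
    if "\<And>x. (G has_real_derivative g x) (at x)" "\<And>x. x \<le> 0 \<Longrightarrow> g x = 0" for G g :: "real \<Rightarrow> real" and t
  proof (cases "t \<le> 0")
    case True
    have d: "(G has_real_derivative 0) (at x)" if "x \<le> 0" for x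
      using \<open>\<And>x. (G has_real_derivative g x) (at x)\<close>[of x] \<open>\<And>x. x \<le> 0 \<Longrightarrow> g x = 0\<close>[OF that] by simp
    have "G t \<le> G 0"
      by (rule le_of_deriv_nonneg[where F = G and F' = "\<lambda>_. 0"]) (use d True in auto)
    moreover have "- G t \<le> - G 0"
    proof (rule le_of_deriv_nonneg[where F = "\<lambda>x. - G x" and F' = "\<lambda>_. - 0"])
      fix x :: real assume "x \<le> 0"
      thus "((\<lambda>x. - G x) has_real_derivative - 0) (at x)" by (rule DERIV_minus[OF d])
    qed (use True in auto)
    ultimately have "G t = G 0" by linarith
    thus ?thesis using max.absorb1[OF True] by (simp only:)
  qed (simp add: max_def)
  have u_eq': "u t = m * t + (t * (G1 t - G1 0) - (G2 t - G2 0))" for t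
    using u_eq[of t] const[OF G1 y_neg, of t] const[OF G2, of t] y_neg by simp
  show thesis
  proof (rule that[of u "\<lambda>t. m + (G1 t - G1 0)"])
    show "u 0 = 0" by (simp add: u_eq')
    show "m + (G1 0 - G1 0) = m" by simp
    fix t
    have "((\<lambda>t. m * t + (t * (G1 t - G1 0) - (G2 t - G2 0))) has_real_derivative
        m * 1 + ((1 * (G1 t - G1 0) + (y w t - 0) * t) - (t * y w t - 0))) (at t)"
      by (intro DERIV_add DERIV_diff DERIV_mult DERIV_cmult DERIV_ident DERIV_const G1 G2)
    moreover have "u = (\<lambda>t. m * t + (t * (G1 t - G1 0) - (G2 t - G2 0)))"
      by (rule ext) (rule u_eq')
    ultimately show "(u has_real_derivative m + (G1 t - G1 0)) (at t)" by (simp add: mult.commute)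
    have "((\<lambda>t. m + (G1 t - G1 0)) has_real_derivative 0 + (y w t - 0)) (at t)"
      by (intro DERIV_add DERIV_diff DERIV_const G1)
    thus "((\<lambda>t. m + (G1 t - G1 0)) has_real_derivative h t * clamped_cubic (u t)) (at t)"
      by (simp add: yu)
  qed
qed

text \<open>Continuous dependence on the initial slope and on the coefficient, from a Gronwall estimate
  for the squared distance in the phase plane.\<close>

lemma clamped_flow_stability:
  fixes h k :: "real \<Rightarrow> real"
  assumes du: "\<And>t. (u has_real_derivative v t) (at t)" "\<And>t. (x has_real_derivative z t) (at t)"
    and dv: "\<And>t. \<sigma> \<le> t \<Longrightarrow> (v has_real_derivative h t * clamped_cubic (u t)) (at t)"
      "\<And>t. \<sigma> \<le> t \<Longrightarrow> (z has_real_derivative k t * clamped_cubic (x t)) (at t)"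
    and k: "\<And>t. \<bar>k t\<bar> \<le> H"
    and hk: "\<And>t. \<sigma> \<le> t \<Longrightarrow> t \<le> \<tau> \<Longrightarrow> \<bar>h t - k t\<bar> \<le> \<eta>"
    and "\<sigma> \<le> \<tau>" "0 \<le> \<eta>"
  shows "(u \<tau> - x \<tau>)^2 + (v \<tau> - z \<tau>)^2
    \<le> exp ((2 + 2 * H) * (\<tau> - \<sigma>)) * ((u \<sigma> - x \<sigma>)^2 + (v \<sigma> - z \<sigma>)^2 + \<eta>^2 * (\<tau> - \<sigma>))"
proof -
  define K where "K = 2 + 2 * H"
  have H: "0 \<le> H" using k[of 0] by linarith
  define Z where "Z t = (u t - x t)^2 + (v t - z t)^2" for t
  define Z' where "Z' t = 2 * (u t - x t) * (v t - z t)
    + 2 * (v t - z t) * (h t * clamped_cubic (u t) - k t * clamped_cubic (x t))" for t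
  define E where "E t = \<eta>^2 * (t - \<sigma>) - exp (- K * (t - \<sigma>)) * Z t" for t
  have Z'_le: "Z' t \<le> K * Z t + \<eta>^2" if "\<sigma> \<le> t" "t \<le> \<tau>" for t
  proof -
    define a b where "a = \<bar>u t - x t\<bar>" and "b = \<bar>v t - z t\<bar>"
    have "h t * clamped_cubic (u t) - k t * clamped_cubic (x t)
        = (h t - k t) * clamped_cubic (u t) + k t * (clamped_cubic (u t) - clamped_cubic (x t))"
      by algebra
    also have "\<bar>\<dots>\<bar> \<le> \<bar>(h t - k t) * clamped_cubic (u t)\<bar>
        + \<bar>k t * (clamped_cubic (u t) - clamped_cubic (x t))\<bar>" by (rule abs_triangle_ineq)
    also have "\<bar>(h t - k t) * clamped_cubic (u t)\<bar> \<le> \<eta> * 1" unfolding abs_mult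
      by (intro mult_mono hk that clamped_cubic_bounds) (use \<open>0 \<le> \<eta>\<close> in auto)
    also have "\<bar>k t * (clamped_cubic (u t) - clamped_cubic (x t))\<bar> \<le> H * (2 * a)"
      unfolding abs_mult a_def by (intro mult_mono k clamped_cubic_lipschitz) (use H in auto)
    finally have "\<bar>h t * clamped_cubic (u t) - k t * clamped_cubic (x t)\<bar> \<le> \<eta> + 2 * H * a"
      by simp
    hence "b * \<bar>h t * clamped_cubic (u t) - k t * clamped_cubic (x t)\<bar> \<le> b * (\<eta> + 2 * H * a)"
      by (intro mult_left_mono) (auto simp: b_def)
    hence 1: "\<bar>(v t - z t) * (h t * clamped_cubic (u t) - k t * clamped_cubic (x t))\<bar>
        \<le> b * (\<eta> + 2 * H * a)" by (simp add: abs_mult b_def)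
    have 2: "\<bar>(u t - x t) * (v t - z t)\<bar> = a * b" by (simp add: abs_mult a_def b_def)
    have 3: "2 * a * b \<le> a^2 + b^2" "2 * b * \<eta> \<le> b^2 + \<eta>^2"
      using sum_squares_bound[of a b] sum_squares_bound[of b \<eta>] by simp_all
    have "2 * b * (2 * H * a) = (2 * H) * (2 * a * b)" by simp
    also have "\<dots> \<le> 2 * H * (a^2 + b^2)" using 3 H by (intro mult_left_mono) auto
    finally have 4: "2 * b * (2 * H * a) \<le> 2 * H * (a^2 + b^2)" .
    have "Z' t = 2 * ((u t - x t) * (v t - z t))
        + 2 * ((v t - z t) * (h t * clamped_cubic (u t) - k t * clamped_cubic (x t)))"
      unfolding Z'_def by algebra
    hence "Z' t \<le> 2 * (a * b) + 2 * (b * (\<eta> + 2 * H * a))"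
      using 1 2 by linarith
    also have "\<dots> = 2 * a * b + 2 * b * \<eta> + 2 * b * (2 * H * a)" by algebra
    also have "\<dots> \<le> (a^2 + b^2) + (b^2 + \<eta>^2) + 2 * H * (a^2 + b^2)" using 3 4 by linarith
    also have "\<dots> \<le> K * (a^2 + b^2) + \<eta>^2"
      by (simp add: K_def algebra_simps)
    finally show ?thesis by (simp add: Z_def a_def b_def)
  qed
  have "E \<sigma> \<le> E \<tau>"
  proof (rule le_of_deriv_nonneg[where F = E])
    fix t assume t: "\<sigma> \<le> t" "t \<le> \<tau>"
    have "(Z has_real_derivative Z' t) (at t)" unfolding Z_def Z'_def
      by (auto intro!: derivative_eq_intros du dv t simp: algebra_simps)
    thus "(E has_real_derivative \<eta>^2 + exp (- K * (t - \<sigma>)) * (K * Z t - Z' t)) (at t)"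
      unfolding E_def by (auto intro!: derivative_eq_intros simp: algebra_simps)
    have "exp (- K * (t - \<sigma>)) * (Z' t - K * Z t) \<le> exp (- K * (t - \<sigma>)) * \<eta>^2"
      using Z'_le[OF t] by (intro mult_left_mono) auto
    also have "0 \<le> K * (t - \<sigma>)" using t H by (simp add: K_def)
    hence "exp (- K * (t - \<sigma>)) * \<eta>^2 \<le> 1 * \<eta>^2" by (intro mult_right_mono) auto
    finally show "0 \<le> \<eta>^2 + exp (- K * (t - \<sigma>)) * (K * Z t - Z' t)"
      by (simp add: algebra_simps)
  qed fact
  hence "exp (- K * (\<tau> - \<sigma>)) * Z \<tau> \<le> Z \<sigma> + \<eta>^2 * (\<tau> - \<sigma>)" by (simp add: E_def)
  hence le: "exp (K * (\<tau> - \<sigma>)) * (exp (- K * (\<tau> - \<sigma>)) * Z \<tau>)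
      \<le> exp (K * (\<tau> - \<sigma>)) * (Z \<sigma> + \<eta>^2 * (\<tau> - \<sigma>))"
    by (rule mult_left_mono) simp
  have "Z \<tau> = exp (K * (\<tau> - \<sigma>)) * (exp (- K * (\<tau> - \<sigma>)) * Z \<tau>)"
    by (simp add: exp_minus)
  from ord_eq_le_trans[OF this le] show ?thesis unfolding Z_def K_def .
qed

section \<open>Half-line kinks\<close>

text \<open>A solution with derivative \<open>v\<close> that rises from \<open>0\<close> and stays in \<open>[0, 1]\<close> for positive times, where
clamping has no effect. That it tends to \<open>1\<close> is a consequence. The values at negative times serve only to make derivatives
at \<open>0\<close> two-sided.\<close>

definition kink :: "(real \<Rightarrow> real) \<Rightarrow> (real \<Rightarrow> real) \<Rightarrow> (real \<Rightarrow> real) \<Rightarrow> bool" where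
  "kink h u v \<longleftrightarrow> u 0 = 0 \<and> 0 < v 0 \<and> (\<forall>t. (u has_real_derivative v t) (at t)) \<and>
     (\<forall>t. (v has_real_derivative h t * clamped_cubic (u t)) (at t)) \<and>
     (\<forall>t\<ge>0. u t \<le> 1 \<and> 0 \<le> v t)"

locale pinched =
  fixes h :: "real \<Rightarrow> real" and \<alpha> \<beta> :: real
  assumes h_cont: "continuous_on UNIV h" and \<alpha>_pos: "0 < \<alpha>"
    and h_ge: "\<And>t. \<alpha> \<le> h t" and h_le: "\<And>t. h t \<le> \<beta>"
begin

lemma h_pos: "0 < h t"
  using \<alpha>_pos h_ge[of t] by linarith

lemma \<beta>_pos: "0 < \<beta>"
  using h_pos[of 0] h_le[of 0] by linarith

lemma h_abs: "\<bar>h t\<bar> \<le> \<beta>"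
  using h_pos[of t] h_le[of t] by linarith

lemma forcing_nonpos: "h t * clamped_cubic x \<le> 0"
  using h_pos[of t] clamped_cubic_bounds(1)[of x] by (simp add: mult_nonneg_nonpos)

lemma forcing_ge: "- \<beta> \<le> h t * clamped_cubic x"
proof -
  have "\<bar>h t * clamped_cubic x\<bar> \<le> \<beta> * 1" unfolding abs_mult
    by (intro mult_mono h_abs clamped_cubic_bounds) (use \<beta>_pos in auto)
  thus ?thesis by linarith
qed

text \<open>Shooting in the initial slope \<open>m\<close>. A large slope overshoots \<open>1\<close> and a small one makes the
trajectory turn back. Both behaviours are open, and they exclude each other because a clamped trajectory that has passed
\<open>1\<close> never turns back. Connectedness of the positive half-line leaves a slope with neither, which is a kink.\<close>

lemma kink_exists: "\<exists>u v. kink h u v"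
proof (rule ccontr)
  assume no: "\<not> ?thesis"
  define P where "P m u v \<longleftrightarrow> u 0 = 0 \<and> v 0 = m \<and> (\<forall>t. (u has_real_derivative v t) (at t)) \<and>
     (\<forall>t. (v has_real_derivative h t * clamped_cubic (u t)) (at t))" for m and u v :: "real \<Rightarrow> real"
  have "\<exists>u v. P m u v" if "0 < m" for m
    using clamped_ivp_exists[OF h_cont h_abs \<beta>_pos, of m] that unfolding P_def
    by (metis less_eq_real_def)
  then obtain U V where UV: "\<And>m. 0 < m \<Longrightarrow> P m (U m) (V m)"
    by metis
  have U0: "U m 0 = 0" "V m 0 = m" if "0 < m" for m using UV[OF that] by (auto simp: P_def)
  have dU: "(U m has_real_derivative V m t) (at t)" if "0 < m" for m t
    using UV[OF that] by (auto simp: P_def)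
  have dV: "(V m has_real_derivative h t * clamped_cubic (U m t)) (at t)" if "0 < m" for m t
    using UV[OF that] by (auto simp: P_def)
  have V_anti: "V m t \<le> V m s" if "0 < m" "s \<le> t" for m s t
    using le_of_deriv_nonneg[of s t "\<lambda>t. - V m t" "\<lambda>t. - (h t * clamped_cubic (U m t))"]
      forcing_nonpos that by (auto intro!: DERIV_minus dV)
  have stab: "\<bar>U m t - U n t\<bar> \<le> exp ((1 + \<beta>) * t) * \<bar>m - n\<bar> \<and>
      \<bar>V m t - V n t\<bar> \<le> exp ((1 + \<beta>) * t) * \<bar>m - n\<bar>"
    if "0 < m" "0 < n" "0 \<le> t" for m n t
  proof -
    have "(U m t - U n t)^2 + (V m t - V n t)^2
        \<le> exp ((2 + 2 * \<beta>) * (t - 0)) * ((U m 0 - U n 0)^2 + (V m 0 - V n 0)^2 + 0^2 * (t - 0))"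
      by (rule clamped_flow_stability[where h = h and k = h])
        (use that dU dV h_abs in auto)
    also have "exp ((2 + 2 * \<beta>) * (t - 0)) = (exp ((1 + \<beta>) * t))^2"
      by (simp add: exp_double[symmetric] algebra_simps)
    also have "(exp ((1 + \<beta>) * t))^2 * ((U m 0 - U n 0)^2 + (V m 0 - V n 0)^2 + 0^2 * (t - 0))
        = (exp ((1 + \<beta>) * t) * (m - n))^2"
      using that by (simp add: U0 power_mult_distrib)
    finally have "(U m t - U n t)^2 \<le> (exp ((1 + \<beta>) * t) * (m - n))^2"
      "(V m t - V n t)^2 \<le> (exp ((1 + \<beta>) * t) * (m - n))^2"
      using zero_le_power2[of "U m t - U n t"] zero_le_power2[of "V m t - V n t"] by linarith+
    thus ?thesis by (simp add: abs_le_square_iff[symmetric] abs_mult)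
  qed
  have cU: "continuous_on {0<..} (\<lambda>m. U m t)" and cV: "continuous_on {0<..} (\<lambda>m. V m t)"
    if "0 \<le> t" for t
    by (rule lipschitz_on_continuous_on[of "exp ((1 + \<beta>) * t)"], rule lipschitz_onI,
        use stab that in \<open>auto simp: dist_real_def\<close>)+
  define A where "A = (\<Union>t\<in>{0..}. ((\<lambda>m. U m t) -` {1<..} \<inter> {0<..}) \<inter> ((\<lambda>m. V m t) -` {0<..} \<inter> {0<..}))"
  define B where "B = (\<Union>t\<in>{0..}. (\<lambda>m. V m t) -` {..<0} \<inter> {0<..})"
  have opens: "open ((\<lambda>m. U m t) -` S \<inter> {0<..})" "open ((\<lambda>m. V m t) -` S \<inter> {0<..})"
    if "0 \<le> t" "open S" for t S
    using cU[OF that(1)] cV[OF that(1)] that(2) by (auto simp: continuous_on_open_vimage)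
  have "open A" "open B" unfolding A_def B_def
    by (intro open_UN ballI open_Int opens; simp)+
  moreover have "A \<inter> B \<inter> {0<..} = {}"
  proof (rule ccontr)
    assume "A \<inter> B \<inter> {0<..} \<noteq> {}"
    then obtain m t s where m: "0 < m" and t: "0 \<le> t" "1 < U m t" "0 < V m t"
      and s: "0 \<le> s" "V m s < 0" by (auto simp: A_def B_def)
    have ts: "t \<le> s" using V_anti[OF m, of s t] t s by linarith
    \<comment> \<open>Above 1 the clamped equation is \<open>u'' = 0\<close>: the trajectory escapes along a straight line.\<close>
    have "(U m s - (U m t + V m t * (s - t)))^2 + (V m s - V m t)^2
      \<le> exp ((2 + 2 * \<beta>) * (s - t)) * ((U m t - (U m t + V m t * (t - t)))^2
          + (V m t - V m t)^2 + 0^2 * (s - t))"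
    proof (rule clamped_flow_stability[where h = h and k = h])
      fix r assume r: "t \<le> r"
      have "1 \<le> U m t + V m t * (r - t)" using t r by (simp add: add_increasing2)
      thus "((\<lambda>_. V m t) has_real_derivative h r * clamped_cubic (U m t + V m t * (r - t))) (at r)"
        by simp
    qed (use m dU dV h_abs ts in \<open>auto intro!: derivative_eq_intros\<close>)
    hence "(U m s - (U m t + V m t * (s - t)))^2 + (V m s - V m t)^2 \<le> 0" by simp
    hence "(V m s - V m t)^2 \<le> 0" using zero_le_power2[of "U m s - (U m t + V m t * (s - t))"] by linarith
    thus False using t s by simp
  qed
  moreover have "{0<..} \<subseteq> A \<union> B"
  proof
    fix m :: real assume "m \<in> {0<..}"
    hence m: "0 < m" by simp
    show "m \<in> A \<union> B"
    proof (rule ccontr)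
      assume "m \<notin> A \<union> B"
      hence nA: "V m t \<le> 0" if "0 \<le> t" "1 < U m t" for t
        using m that unfolding A_def by (force simp: not_less)
      have V0: "0 \<le> V m t" if "0 \<le> t" for t
        using \<open>m \<notin> A \<union> B\<close> m that unfolding B_def by (force simp: not_less)
      have U_mono: "U m s \<le> U m t" if "0 \<le> s" "s \<le> t" for s t
        by (rule le_of_deriv_nonneg[where F = "U m" and F' = "V m"])
          (use that V0 dU[OF m] in auto)
      have "U m t \<le> 1" if "0 \<le> t" for t
      proof (rule ccontr)
        assume "\<not> U m t \<le> 1"
        hence t: "1 < U m t" by simp
        have "\<exists>x\<ge>0. x \<le> t \<and> U m x = (1 + U m t) / 2"
          by (rule IVT) (use that t U0[OF m] dU[OF m] in \<open>auto intro: DERIV_isCont\<close>)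
        then obtain x where x: "0 \<le> x" "x \<le> t" "U m x = (1 + U m t) / 2" by auto
        with t have "x < t" by (cases "x = t") auto
        then obtain z where z: "x < z" "z < t" "U m t - U m x = (t - x) * V m z"
          using MVT2[of x t "U m" "V m"] dU[OF m] by auto
        have "0 < (t - x) * V m z" unfolding z(3)[symmetric] x(3) using t by (simp add: field_simps)
        hence "0 < V m z" using \<open>x < t\<close> by (simp add: zero_less_mult_iff)
        moreover have "1 < U m z"
        proof -
          have "U m x \<le> U m z" using U_mono[of x z] x z by simp
          moreover have "1 < U m x" unfolding x(3) using t by (simp add: field_simps)
          ultimately show ?thesis by simp
        qed
        ultimately show False using nA[of z] x z by linarith
      qed
      hence "kink h (U m) (V m)" using m U0[OF m] dU[OF m] dV[OF m] V0 by (auto simp: kink_def)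
      with no show False by blast
    qed
  qed
  ultimately have "A \<inter> {0<..} = {} \<or> B \<inter> {0<..} = {}"
    by (intro connectedD) (simp_all add: convex_connected)
  moreover have "A \<inter> {0<..} \<noteq> {}"
  proof -
    define m where "m = \<beta> + 2"
    have m: "0 < m" using \<beta>_pos by (simp add: m_def)
    have V2: "2 \<le> V m t" if "0 \<le> t" "t \<le> 1" for t
    proof -
      have "V m 0 + \<beta> * 0 \<le> V m t + \<beta> * t"
      proof (rule le_of_deriv_nonneg[where F = "\<lambda>t. V m t + \<beta> * t"
            and F' = "\<lambda>t. h t * clamped_cubic (U m t) + \<beta>"])
        fix x show "0 \<le> h x * clamped_cubic (U m x) + \<beta>" using forcing_ge[of x "U m x"] by linarith
      qed (use that in \<open>auto intro!: derivative_eq_intros dV[OF m]\<close>)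
      moreover have "\<beta> * t \<le> \<beta> * 1" using that \<beta>_pos by (intro mult_left_mono) auto
      ultimately show ?thesis using U0[OF m] by (simp add: m_def)
    qed
    have "U m 0 - 2 * 0 \<le> U m 1 - 2 * 1"
      by (rule le_of_deriv_nonneg[where F = "\<lambda>t. U m t - 2 * t" and F' = "\<lambda>t. V m t - 2"])
        (use V2 in \<open>auto intro!: derivative_eq_intros dU[OF m]\<close>)
    hence "1 < U m 1" "0 < V m 1" using U0[OF m] V2[of 1] by auto
    hence "m \<in> A" using m unfolding A_def by (intro UN_I[of 1]) auto
    with m show ?thesis by auto
  qed
  moreover have "B \<inter> {0<..} \<noteq> {}"
  proof
    assume B: "B \<inter> {0<..} = {}"
    \<comment> \<open>Below \<open>1/2\<close> the force exceeds that of the linear oscillator of frequency \<open>k\<close>, and \<open>m\<close> is so small that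
        the trajectory stays below \<open>1/2\<close> for a half period; Sturm comparison makes it turn back within that time.\<close>
    define k where "k = sqrt (3 * \<alpha> / 4)"
    have k: "0 < k" "k^2 = 3 * \<alpha> / 4" using \<alpha>_pos by (auto simp: k_def)
    define \<tau> where "\<tau> = pi / k"
    have \<tau>: "0 < \<tau>" "k * \<tau> = pi" using k by (auto simp: \<tau>_def)
    define m where "m = 1 / (2 * \<tau>)"
    have m: "0 < m" using \<tau> by (simp add: m_def)
    have V0: "0 \<le> V m t" if "0 \<le> t" for t
    proof (rule ccontr)
      assume "\<not> 0 \<le> V m t"
      hence "m \<in> B" using m that unfolding B_def by (intro UN_I[of t]) auto
      with B m show False by auto
    qed
    have U_mono: "U m s \<le> U m t" if "0 \<le> s" "s \<le> t" for s t
      by (rule le_of_deriv_nonneg[where F = "U m" and F' = "V m"])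
        (use that V0 dU[OF m] in auto)
    have U_le: "U m t \<le> 1/2" if "0 \<le> t" "t \<le> \<tau>" for t
    proof -
      have "m * 0 - U m 0 \<le> m * t - U m t"
        by (rule le_of_deriv_nonneg[where F = "\<lambda>t. m * t - U m t" and F' = "\<lambda>t. m - V m t"])
          (use that V_anti[OF m, of 0] U0[OF m] in \<open>auto intro!: derivative_eq_intros dU[OF m]\<close>)
      moreover have "m * t \<le> m * \<tau>" using m that by (intro mult_left_mono) auto
      moreover have "m * \<tau> = 1/2" using \<tau> by (simp add: m_def)
      ultimately show ?thesis using U0[OF m] by simp
    qed
    have "k * U m 0 * cos (k * 0) - V m 0 * sin (k * 0) \<le> k * U m \<tau> * cos (k * \<tau>) - V m \<tau> * sin (k * \<tau>)"
    proof (rule le_of_deriv_nonneg[where F = "\<lambda>t. k * U m t * cos (k * t) - V m t * sin (k * t)"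
          and F' = "\<lambda>t. - (h t * clamped_cubic (U m t) + k^2 * U m t) * sin (k * t)"])
      fix t assume t: "0 \<le> t" "t \<le> \<tau>"
      show "((\<lambda>t. k * U m t * cos (k * t) - V m t * sin (k * t)) has_real_derivative
          - (h t * clamped_cubic (U m t) + k^2 * U m t) * sin (k * t)) (at t)"
        by (auto intro!: derivative_eq_intros dU[OF m] dV[OF m] simp: algebra_simps power2_eq_square)
      have u: "0 \<le> U m t" "U m t \<le> 1/2" using U_mono[of 0 t] U_le t U0[OF m] by auto
      have "(U m t)^2 \<le> (1/2)^2" using u by (intro power_mono) auto
      hence "3/4 * U m t \<le> (1 - (U m t)^2) * U m t" using u
        by (intro mult_right_mono) (auto simp: power2_eq_square)
      hence le: "clamped_cubic (U m t) \<le> - (3/4 * U m t)"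
        using u by (simp add: clamped_cubic_eq power3_eq_cube power2_eq_square algebra_simps)
      have "h t * clamped_cubic (U m t) \<le> h t * (- (3/4 * U m t))"
        using le h_pos[of t] by (intro mult_left_mono) auto
      also have "\<dots> \<le> - (k^2 * U m t)"
        using mult_right_mono[OF h_ge[of t], of "3/4 * U m t"] u by (simp add: k)
      finally have "h t * clamped_cubic (U m t) + k^2 * U m t \<le> 0" by simp
      moreover have "0 \<le> sin (k * t)"
      proof (rule sin_ge_zero)
        show "k * t \<le> pi" using mult_left_mono[OF t(2), of k] k \<tau> by simp
      qed (use k t in auto)
      ultimately show "0 \<le> - (h t * clamped_cubic (U m t) + k^2 * U m t) * sin (k * t)"
        by (simp add: mult_nonpos_nonneg)
    qed (use \<tau> in auto)
    hence "U m \<tau> \<le> 0" using U0[OF m] k by (simp add: \<tau> mult_le_0_iff)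
    moreover obtain d where d: "0 < d" "\<And>e. 0 < e \<Longrightarrow> e < d \<Longrightarrow> U m 0 < U m (0 + e)"
      using DERIV_pos_inc_right[OF dU[OF m, of 0]] U0[OF m] m by auto
    have "0 < U m (min \<tau> (d/2))" using d(2)[of "min \<tau> (d/2)"] d(1) \<tau> U0[OF m] by auto
    moreover have "U m (min \<tau> (d/2)) \<le> U m \<tau>" using U_mono[of "min \<tau> (d/2)" \<tau>] \<tau> d by auto
    ultimately show False by linarith
  qed
  ultimately show False by blast
qed

end

locale half_kink = pinched +
  fixes u v :: "real \<Rightarrow> real"
  assumes is_kink: "kink h u v"
begin

lemma u0 [simp]: "u 0 = 0" and v0_pos: "0 < v 0"
  and du: "(u has_real_derivative v t) (at t)"
  and dv: "(v has_real_derivative h t * clamped_cubic (u t)) (at t)"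
  and u_le1: "0 \<le> t \<Longrightarrow> u t \<le> 1" and v_ge0: "0 \<le> t \<Longrightarrow> 0 \<le> v t"
  using is_kink by (auto simp: kink_def)

lemma u_mono: "0 \<le> s \<Longrightarrow> s \<le> t \<Longrightarrow> u s \<le> u t"
  by (rule le_of_deriv_nonneg[where F = u and F' = v]) (auto simp: du v_ge0)

lemma u_ge0: "0 \<le> t \<Longrightarrow> 0 \<le> u t"
  using u_mono[of 0 t] by simp

lemma dv': "0 \<le> t \<Longrightarrow> (v has_real_derivative h t * (u t ^ 3 - u t)) (at t)"
  using dv[of t] u_le1 u_ge0 by (simp add: clamped_cubic_eq)

lemma v_anti: "s \<le> t \<Longrightarrow> v t \<le> v s"
  using le_of_deriv_nonneg[of s t "\<lambda>t. - v t" "\<lambda>t. - (h t * clamped_cubic (u t))"]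
    forcing_nonpos by (auto intro!: DERIV_minus dv)

lemma u_le_linear: assumes "0 \<le> t" shows "u t \<le> v 0 * t"
proof -
  have "v 0 * 0 - u 0 \<le> v 0 * t - u t"
    by (rule le_of_deriv_nonneg[where F = "\<lambda>t. v 0 * t - u t" and F' = "\<lambda>t. v 0 - v t"])
      (use v_anti assms in \<open>auto intro!: derivative_eq_intros du\<close>)
  thus ?thesis by simp
qed

lemma u_ge_slope: "0 \<le> t \<Longrightarrow> t * v t \<le> u t"
proof -
  assume t: "0 \<le> t"
  have "u 0 - 0 * v 0 \<le> u t - t * v t"
  proof (rule le_of_deriv_nonneg[where F = "\<lambda>t. u t - t * v t"
        and F' = "\<lambda>t. - (t * (h t * clamped_cubic (u t)))"])
    fix x :: real assume "0 \<le> x"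
    thus "0 \<le> - (x * (h x * clamped_cubic (u x)))" using forcing_nonpos[of x "u x"]
      by (simp add: mult_nonneg_nonpos)
  qed (use t in \<open>auto intro!: derivative_eq_intros du dv\<close>)
  thus ?thesis by simp
qed

lemma u_pos: assumes "0 < t" shows "0 < u t"
proof -
  obtain d where d: "0 < d" "\<And>e. 0 < e \<Longrightarrow> e < d \<Longrightarrow> u 0 < u (0 + e)"
    using DERIV_pos_inc_right[OF du[of 0] v0_pos] by auto
  have "0 < u (min t (d/2))" using d(2)[of "min t (d/2)"] d(1) assms by auto
  also have "\<dots> \<le> u t" using u_mono[of "min t (d/2)" t] assms d by auto
  finally show ?thesis .
qed

text \<open>If \<open>u\<close> stayed below some \<open>y < 1\<close>, then \<open>u (1 - u\<^sup>2)\<close> would be bounded below and \<open>v\<close> would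
become negative after a finite time.\<close>

lemma u_tendsto: "(u \<longlongrightarrow> 1) at_top"
proof (rule increasing_tendsto)
  show "eventually (\<lambda>t. u t \<le> 1) at_top"
    using eventually_ge_at_top[of 0] by eventually_elim (rule u_le1)
  fix x :: real assume x: "x < 1"
  define y where "y = max x 0"
  have y: "0 \<le> y" "y < 1" "x \<le> y" using x by (auto simp: y_def)
  define c where "c = u 1 * (1 - y^2)"
  have "y^2 < 1" using y by (simp add: power_less_one_iff abs_square_less_1)
  hence c: "0 < c" using u_pos[of 1] by (simp add: c_def)
  define t where "t = 2 + v 1 / (\<alpha> * c)"
  have t: "1 < t" using v_ge0[of 1] c \<alpha>_pos by (simp add: t_def add_pos_nonneg)
  have "y < u t"
  proof (rule ccontr)
    assume "\<not> y < u t"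
    hence u_le: "u r \<le> y" if "1 \<le> r" "r \<le> t" for r using u_mono[of r t] that by linarith
    have "- (v 1 + \<alpha> * c * 1) \<le> - (v t + \<alpha> * c * t)"
    proof (rule le_of_deriv_nonneg[where F = "\<lambda>t. - (v t + \<alpha> * c * t)"
          and F' = "\<lambda>t. - (h t * (u t ^ 3 - u t) + \<alpha> * c)"])
      fix r assume r: "1 \<le> r" "r \<le> t"
      show "((\<lambda>t. - (v t + \<alpha> * c * t)) has_real_derivative - (h r * (u r ^ 3 - u r) + \<alpha> * c)) (at r)"
        using r by (auto intro!: derivative_eq_intros dv')
      have "(u r)^2 \<le> y^2" using u_le[OF r] u_ge0[of r] r by (intro power_mono) auto
      hence "c \<le> u r * (1 - (u r)^2)" unfolding c_def
        using u_mono[of 1 r] r u_ge0[of 1] \<open>y^2 < 1\<close> by (intro mult_mono) auto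
      hence "\<alpha> * c \<le> h r * (u r * (1 - (u r)^2))"
        using h_ge[of r] \<alpha>_pos h_pos[of r] c by (intro mult_mono) auto
      also have "\<dots> = - (h r * (u r ^ 3 - u r))" by algebra
      finally show "0 \<le> - (h r * (u r ^ 3 - u r) + \<alpha> * c)" by simp
    qed (use t in auto)
    hence "v t \<le> v 1 - \<alpha> * c * (t - 1)" by (simp add: algebra_simps)
    also have "\<dots> = - (\<alpha> * c)" using \<alpha>_pos c by (simp add: t_def field_simps)
    also have "\<dots> < 0" using \<alpha>_pos c by simp
    finally show False using v_ge0[of t] t by linarith
  qed
  thus "eventually (\<lambda>t. x < u t) at_top"
    using eventually_ge_at_top[of t]
    by (elim eventually_mono) (use u_mono[of t] t y in \<open>force\<close>)
qed

lemma v_tendsto: "(v \<longlongrightarrow> 0) at_top"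
proof (rule tendsto_sandwich)
  show "eventually (\<lambda>t. 0 \<le> v t) at_top"
    using eventually_ge_at_top[of 0] by eventually_elim (rule v_ge0)
  show "eventually (\<lambda>t. v t \<le> inverse t) at_top"
    using eventually_gt_at_top[of 0]
  proof eventually_elim
    case (elim t)
    hence "t * v t \<le> 1" using u_ge_slope[of t] u_le1[of t] by linarith
    with elim show ?case by (simp add: field_simps)
  qed
qed (auto intro: tendsto_inverse_0_at_top filterlim_ident)

text \<open>The energies \<open>v^2/2 - c * (1 - u^2)^2/4\<close> with \<open>c\<close> equal to the lower and the upper bound of the
  coefficient are monotone, and both vanish at infinity.\<close>

lemma energy_bounds:
  assumes "0 \<le> t"
  shows "\<alpha> / 2 * (1 - (u t)^2)^2 \<le> (v t)^2" "(v t)^2 \<le> \<beta> / 2 * (1 - (u t)^2)^2"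
proof -
  define E where "E c t = (v t)^2 / 2 - c * (1 - (u t)^2)^2 / 4" for c t
  have lim: "(E c \<longlongrightarrow> 0) at_top" for c
  proof -
    have "(E c \<longlongrightarrow> 0^2 / 2 - c * (1 - 1^2)^2 / 4) at_top"
      unfolding E_def by (intro tendsto_intros u_tendsto v_tendsto) auto
    thus ?thesis by simp
  qed
  have dE: "(E c has_real_derivative (c - h t) * (v t * (u t * (1 - (u t)^2)))) (at t)"
    if "0 \<le> t" for c t
    unfolding E_def using that
    by (auto intro!: derivative_eq_intros du dv' simp: field_simps power2_eq_square power3_eq_cube)
  have nn: "0 \<le> v t * (u t * (1 - (u t)^2))" if "0 \<le> t" for t
    using v_ge0[OF that] u_ge0[OF that] u_le1[OF that] by (simp add: power_le_one)
  have "0 \<le> E \<alpha> t"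
  proof (rule tendsto_upperbound[OF lim])
    have "- E \<alpha> t \<le> - E \<alpha> s" if "t \<le> s" for s
    proof (rule le_of_deriv_nonneg[where F = "\<lambda>t. - E \<alpha> t", OF DERIV_minus[OF dE]])
      fix x assume x: "t \<le> x"
      show "0 \<le> x" using x assms by linarith
      thus "0 \<le> - ((\<alpha> - h x) * (v x * (u x * (1 - (u x)^2))))"
        using mult_nonpos_nonneg[of "\<alpha> - h x", OF _ nn[of x]] h_ge[of x] by linarith
    qed (rule that)
    thus "eventually (\<lambda>s. E \<alpha> s \<le> E \<alpha> t) at_top"
      using eventually_ge_at_top[of t] by (elim eventually_mono) auto
  qed simp
  thus "\<alpha> / 2 * (1 - (u t)^2)^2 \<le> (v t)^2" by (simp add: E_def)
  have "E \<beta> t \<le> 0"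
  proof (rule tendsto_lowerbound[OF lim])
    have "E \<beta> t \<le> E \<beta> s" if "t \<le> s" for s
    proof (rule le_of_deriv_nonneg[where F = "E \<beta>", OF dE])
      fix x assume x: "t \<le> x"
      show "0 \<le> x" using x assms by linarith
      thus "0 \<le> (\<beta> - h x) * (v x * (u x * (1 - (u x)^2)))"
        using h_le[of x] by (intro mult_nonneg_nonneg[OF _ nn]) auto
    qed (rule that)
    thus "eventually (\<lambda>s. E \<beta> t \<le> E \<beta> s) at_top"
      using eventually_ge_at_top[of t] by (elim eventually_mono) auto
  qed simp
  thus "(v t)^2 \<le> \<beta> / 2 * (1 - (u t)^2)^2" by (simp add: E_def)
qed

lemma v_ge: "0 \<le> t \<Longrightarrow> sqrt (\<alpha> / 2) * (1 - (u t)^2) \<le> v t"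
  and v_le: "0 \<le> t \<Longrightarrow> v t \<le> sqrt (\<beta> / 2) * (1 - (u t)^2)"
proof -
  assume t: "0 \<le> t"
  have nn: "0 \<le> 1 - (u t)^2" using u_ge0[OF t] u_le1[OF t] by (simp add: power_le_one)
  show "sqrt (\<alpha> / 2) * (1 - (u t)^2) \<le> v t"
    by (rule power2_le_imp_le) (use energy_bounds(1)[OF t] \<alpha>_pos v_ge0[OF t] in \<open>simp_all add: power_mult_distrib\<close>)
  show "v t \<le> sqrt (\<beta> / 2) * (1 - (u t)^2)"
    by (rule power2_le_imp_le) (use energy_bounds(2)[OF t] \<beta>_pos nn in \<open>simp_all add: power_mult_distrib\<close>)
qed

lemma v0_bounds: "sqrt (\<alpha> / 2) \<le> v 0" "v 0 \<le> sqrt (\<beta> / 2)"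
  using v_ge[of 0] v_le[of 0] by auto

lemma u_decay: assumes "0 \<le> t" shows "1 - u t \<le> exp (- sqrt (\<alpha> / 2) * t)"
proof -
  define a where "a = sqrt (\<alpha> / 2)"
  have a: "0 < a" using \<alpha>_pos by (simp add: a_def)
  have "- ((1 - u 0) * exp (a * 0)) \<le> - ((1 - u t) * exp (a * t))"
  proof (rule le_of_deriv_nonneg[where F = "\<lambda>t. - ((1 - u t) * exp (a * t))"
        and F' = "\<lambda>t. (v t - a * (1 - u t)) * exp (a * t)"])
    fix x :: real assume x: "0 \<le> x"
    have "a * (1 - u x) * 1 \<le> a * (1 - u x) * (1 + u x)"
      using a u_le1[OF x] u_ge0[OF x] by (intro mult_left_mono) auto
    also have "\<dots> = a * (1 - (u x)^2)" by algebra
    also have "\<dots> \<le> v x" using v_ge[OF x] by (simp add: a_def)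
    finally show "0 \<le> (v x - a * (1 - u x)) * exp (a * x)" by simp
    show "((\<lambda>t. - ((1 - u t) * exp (a * t))) has_real_derivative
        (v x - a * (1 - u x)) * exp (a * x)) (at x)"
      by (auto intro!: derivative_eq_intros du simp: algebra_simps)
  qed (rule assms)
  hence "(1 - u t) * exp (a * t) \<le> 1" by simp
  hence "1 - u t \<le> 1 / exp (a * t)" by (simp add: field_simps)
  thus ?thesis by (simp add: exp_minus a_def inverse_eq_divide)
qed

text \<open>The upper energy bound gives \<open>(1 - u)' \<ge> - 2 b (1 - u)\<close>, hence \<open>1 - u \<ge> exp (- 2 b t)\<close>.\<close>

lemma u_less1: assumes "0 \<le> t" shows "u t < 1"
proof -
  define b where "b = sqrt (\<beta> / 2)"
  have b: "0 < b" using \<beta>_pos by (simp add: b_def)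
  have "(1 - u 0) * exp (2 * b * 0) \<le> (1 - u t) * exp (2 * b * t)"
  proof (rule le_of_deriv_nonneg[where F = "\<lambda>t. (1 - u t) * exp (2 * b * t)"
        and F' = "\<lambda>t. (2 * b * (1 - u t) - v t) * exp (2 * b * t)"])
    fix x :: real assume x: "0 \<le> x"
    have "v x \<le> b * (1 - (u x)^2)" using v_le[OF x] by (simp add: b_def)
    also have "\<dots> = b * (1 - u x) * (1 + u x)" by algebra
    also have "\<dots> \<le> b * (1 - u x) * 2"
      using b u_le1[OF x] by (intro mult_left_mono) auto
    finally show "0 \<le> (2 * b * (1 - u x) - v x) * exp (2 * b * x)" by simp
    show "((\<lambda>t. (1 - u t) * exp (2 * b * t)) has_real_derivative
        (2 * b * (1 - u x) - v x) * exp (2 * b * x)) (at x)"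
      by (auto intro!: derivative_eq_intros du simp: algebra_simps)
  qed (rule assms)
  hence "0 < (1 - u t) * exp (2 * b * t)" by simp
  thus ?thesis by (simp add: zero_less_mult_iff)
qed

lemma v_pos: assumes "0 \<le> t" shows "0 < v t"
proof -
  have "(u t)^2 < 1" using u_less1[OF assms] u_ge0[OF assms] by (simp add: power_less_one_iff abs_square_less_1)
  hence "0 < sqrt (\<alpha> / 2) * (1 - (u t)^2)" using \<alpha>_pos by simp
  with v_ge[OF assms] show ?thesis by linarith
qed

lemma v_decay: assumes "0 \<le> t" shows "v t \<le> 2 * sqrt (\<beta> / 2) * exp (- sqrt (\<alpha> / 2) * t)"
proof -
  have "v t \<le> sqrt (\<beta> / 2) * (1 - (u t)^2)" by (rule v_le[OF assms])
  also have "\<dots> = sqrt (\<beta> / 2) * ((1 - u t) * (1 + u t))" by algebra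
  also have "\<dots> \<le> sqrt (\<beta> / 2) * (exp (- sqrt (\<alpha> / 2) * t) * 2)"
    using \<beta>_pos u_decay[OF assms] u_le1[OF assms] u_ge0[OF assms]
    by (intro mult_left_mono mult_mono) auto
  finally show ?thesis by simp
qed

end

section \<open>The action of a half-line kink\<close>

text \<open>The Lagrangian whose Euler-Lagrange equation is \<open>u'' = h (u\<^sup>3 - u)\<close>; the potential is normalised to vanish at
\<open>u = 1\<close>, so that kinks have finite action on the half-line.\<close>

definition action_density :: "(real \<Rightarrow> real) \<Rightarrow> (real \<Rightarrow> real) \<Rightarrow> (real \<Rightarrow> real) \<Rightarrow> real \<Rightarrow> real" where
  "action_density h u v t = (v t)^2 / 2 + h t * (1 - (u t)^2)^2 / 4"

definition action :: "(real \<Rightarrow> real) \<Rightarrow> (real \<Rightarrow> real) \<Rightarrow> (real \<Rightarrow> real) \<Rightarrow> real \<Rightarrow> real" where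
  "action h u v R = integral {0..R} (action_density h u v)"

text \<open>The action is increasing in \<open>R\<close>, so its supremum is the integral over the half-line.\<close>

definition total_action :: "(real \<Rightarrow> real) \<Rightarrow> (real \<Rightarrow> real) \<Rightarrow> (real \<Rightarrow> real) \<Rightarrow> real" where
  "total_action h u v = (SUP R\<in>{0..}. action h u v R)"

context half_kink
begin

lemma u_cont: "continuous_on S u" and v_cont: "continuous_on S v"
  using du dv by (meson DERIV_isCont continuous_at_imp_continuous_on)+

lemma action_antiderivative:
  "\<exists>G. (\<forall>t. (G has_real_derivative action_density h u v t) (at t)) \<and>
    (\<forall>R\<ge>0. action h u v R = G R) \<and> G 0 = 0"
proof -
  have "continuous_on UNIV (action_density h u v)"
    unfolding action_density_def by (intro continuous_intros u_cont v_cont h_cont) auto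
  then obtain G where G: "\<And>t. (G has_real_derivative action_density h u v t) (at t)"
    using real_antiderivative_exists by blast
  show ?thesis
  proof (intro exI[of _ "\<lambda>t. G t - G 0"] conjI allI impI)
    show "((\<lambda>t. G t - G 0) has_real_derivative action_density h u v t) (at t)" for t
      using DERIV_diff[OF G DERIV_const] by simp
    show "action h u v R = G R - G 0" if "0 \<le> R" for R
      using integral_antiderivative[OF G] that by (simp add: action_def max_def)
  qed simp
qed

lemma action_density_nonneg: "0 \<le> action_density h u v t"
  using h_pos[of t] by (simp add: action_density_def)

lemma potential_le: "0 \<le> t \<Longrightarrow> h t * (1 - (u t)^2)^2 / 4 \<le> \<beta> / \<alpha> * ((v t)^2 / 2)"
proof -
  assume t: "0 \<le> t"
  have "h t * (1 - (u t)^2)^2 / 4 \<le> \<beta> * (1 - (u t)^2)^2 / 4"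
    using h_le[of t] by (intro divide_right_mono mult_right_mono) auto
  also have "\<dots> = \<beta> / \<alpha> * (\<alpha> / 2 * (1 - (u t)^2)^2 / 2)" using \<alpha>_pos by simp
  also have "\<dots> \<le> \<beta> / \<alpha> * ((v t)^2 / 2)"
    using \<alpha>_pos \<beta>_pos energy_bounds(1)[OF t] by (intro mult_left_mono divide_right_mono) auto
  finally show ?thesis .
qed

lemma action_density_le: assumes "0 \<le> t"
  shows "action_density h u v t \<le> (1 + \<beta> / \<alpha>) * sqrt (\<beta> / 2) / 2 * v t"
proof -
  have "action_density h u v t \<le> (1 + \<beta> / \<alpha>) * ((v t)^2 / 2)"
    using potential_le[OF assms] by (simp add: action_density_def algebra_simps)
  moreover have "v t \<le> sqrt (\<beta> / 2)" using v_anti[OF assms] v0_bounds(2) by linarith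
  hence "v t * v t \<le> sqrt (\<beta> / 2) * v t" using v_ge0[OF assms]
    by (intro mult_right_mono) auto
  hence "(v t)^2 \<le> sqrt (\<beta> / 2) * v t" unfolding power2_eq_square .
  hence "(1 + \<beta> / \<alpha>) * ((v t)^2 / 2) \<le> (1 + \<beta> / \<alpha>) * (sqrt (\<beta> / 2) * v t / 2)"
    using \<alpha>_pos \<beta>_pos by (intro mult_left_mono divide_right_mono) auto
  ultimately show ?thesis by (simp add: mult.assoc)
qed

lemma action_mono: assumes "0 \<le> r" "r \<le> s" shows "action h u v r \<le> action h u v s"
proof -
  obtain G where G: "\<And>t. (G has_real_derivative action_density h u v t) (at t)"
    "\<And>R. 0 \<le> R \<Longrightarrow> action h u v R = G R" "G 0 = 0"
    using action_antiderivative by blast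
  have "G r \<le> G s" by (rule le_of_deriv_nonneg[OF G(1) action_density_nonneg assms(2)])
  thus ?thesis using assms G(2) by simp
qed

text \<open>By the energy bounds the density is at most a constant times \<open>v = u'\<close>, and \<open>u\<close> is bounded: the action is finite.\<close>

lemma action_le: assumes "0 \<le> R" shows "action h u v R \<le> (1 + \<beta> / \<alpha>) * sqrt (\<beta> / 2) / 2 * u R"
proof -
  obtain G where G: "\<And>t. (G has_real_derivative action_density h u v t) (at t)"
    "\<And>R. 0 \<le> R \<Longrightarrow> action h u v R = G R" "G 0 = 0"
    using action_antiderivative by blast
  define C where "C = (1 + \<beta> / \<alpha>) * sqrt (\<beta> / 2) / 2"
  have "C * u 0 - G 0 \<le> C * u R - G R"
    by (rule le_of_deriv_nonneg[where F = "\<lambda>t. C * u t - G t" and F' = "\<lambda>t. C * v t - action_density h u v t"])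
      (use action_density_le assms in \<open>auto intro!: derivative_eq_intros du G simp: C_def\<close>)
  thus ?thesis using G assms by (simp add: C_def)
qed

lemma action_tendsto: "(action h u v \<longlongrightarrow> total_action h u v) at_top"
proof -
  define C where "C = (1 + \<beta> / \<alpha>) * sqrt (\<beta> / 2) / 2"
  have C: "0 \<le> C" using \<alpha>_pos \<beta>_pos by (simp add: C_def)
  have "action h u v R \<le> C" if "0 \<le> R" for R
    using action_le[OF that] mult_left_mono[OF u_le1[OF that] C] by (simp add: C_def)
  hence bdd: "bdd_above (action h u v ` {0..})" by (auto simp: bdd_above_def)
  show ?thesis
  proof (rule increasing_tendsto)
    show "eventually (\<lambda>R. action h u v R \<le> total_action h u v) at_top"
      using eventually_ge_at_top[of 0]
      by eventually_elim (auto simp: total_action_def intro!: cSUP_upper bdd)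
    fix x assume "x < total_action h u v"
    then obtain r where r: "0 \<le> r" "x < action h u v r"
      unfolding total_action_def by (subst (asm) less_cSUP_iff) (use bdd in auto)
    show "eventually (\<lambda>R. x < action h u v R) at_top"
      using eventually_ge_at_top[of r] by eventually_elim (use action_mono[of r] r in force)
  qed
qed

lemma action_nonneg: "0 \<le> R \<Longrightarrow> 0 \<le> action h u v R"
  using action_mono[of 0 R] by (simp add: action_def)

lemma total_action_nonneg: "0 \<le> total_action h u v"
  by (rule tendsto_lowerbound[OF action_tendsto])
    (auto intro: eventually_mono[OF eventually_ge_at_top[of 0]] action_nonneg)

end

text \<open>Picone's identity for the quartic action: the action density is convex in the square of the
  function, so a positive solution \<open>u\<close> with derivative \<open>v\<close> calibrates every competitor \<open>w\<close>. The last
  summand on the left is half of the derivative of \<open>v * (w^2/u - u)\<close>.\<close>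

lemma picone_inequality:
  fixes h u v w w' :: real
  assumes "0 < u" "0 \<le> h"
  shows "v^2 / 2 + h * (1 - u^2)^2 / 4
      + (h * (u^3 - u) * (w^2 / u - u) + v * (2 * w * w' / u - w^2 * v / u^2 - v)) / 2
    \<le> w'^2 / 2 + h * (1 - w^2)^2 / 4"
proof -
  have "w'^2 / 2 + h * (1 - w^2)^2 / 4 - (v^2 / 2 + h * (1 - u^2)^2 / 4
      + (h * (u^3 - u) * (w^2 / u - u) + v * (2 * w * w' / u - w^2 * v / u^2 - v)) / 2)
    = (w' - w * v / u)^2 / 2 + h * (w^2 - u^2)^2 / 4"
    using assms(1) by (simp add: field_simps power2_eq_square power3_eq_cube)
  moreover have "0 \<le> (w' - w * v / u)^2 / 2 + h * (w^2 - u^2)^2 / 4" using assms(2) by simp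
  ultimately show ?thesis by linarith
qed

context half_kink
begin

text \<open>Half of \<open>v (w\<^sup>2 / u - u)\<close> is the boundary term by which the action of a kink and that of a competitor \<open>w\<close> are
compared, once \<open>picone_inequality\<close> is integrated.\<close>

lemma calibration_deriv:
  assumes "0 < t" "(w has_real_derivative w') (at t)"
  shows "((\<lambda>t. v t * ((w t)^2 / u t - u t) / 2) has_real_derivative
    (h t * ((u t)^3 - u t) * ((w t)^2 / u t - u t)
      + v t * (2 * w t * w' / u t - (w t)^2 * v t / (u t)^2 - v t)) / 2) (at t)"
  using u_pos[OF assms(1)] assms(1)
  by (auto intro!: derivative_eq_intros du dv' assms(2) simp: field_simps power2_eq_square)

text \<open>The calibration applied to the straight line of slope \<open>\<kappa>\<close> through the zero of the kink. The boundary
  term is singular at the common zero, but there it is at most \<open>\<kappa>\<^sup>2 t / 2\<close>, because concavity gives \<open>t v \<le> u\<close>;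
  so it vanishes in the limit. The potential along the line is simply bounded by its value at \<open>0\<close>.\<close>

lemma line_comparison:
  assumes "0 < l" "0 \<le> \<kappa>" "\<kappa> * l \<le> 1"
  shows "action h u v l + v l * ((\<kappa> * l)^2 / u l - u l) / 2 \<le> \<kappa>^2 * l / 2 + integral {0..l} h / 4"
proof -
  obtain G where G: "\<And>t. (G has_real_derivative action_density h u v t) (at t)"
    "\<And>R. 0 \<le> R \<Longrightarrow> action h u v R = G R" "G 0 = 0"
    using action_antiderivative by blast
  obtain K0 where K0: "\<And>t. (K0 has_real_derivative h t) (at t)"
    using real_antiderivative_exists[OF h_cont] by blast
  define K where "K t = K0 t - K0 0" for t
  have K: "(K has_real_derivative h t) (at t)" for t
    unfolding K_def using DERIV_diff[OF K0 DERIV_const] by simp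
  define c where "c t = v t * ((\<kappa> * t)^2 / u t - u t) / 2" for t
  define D where "D t = G t + c t - \<kappa>^2 * t / 2 - K t / 4" for t
  have D_anti: "D l \<le> D e" if e: "0 < e" "e \<le> l" for e
  proof -
    define q where "q t = (h t * ((u t)^3 - u t) * ((\<kappa> * t)^2 / u t - u t)
      + v t * (2 * (\<kappa> * t) * \<kappa> / u t - (\<kappa> * t)^2 * v t / (u t)^2 - v t)) / 2" for t
    have "- D e \<le> - D l"
    proof (rule le_of_deriv_nonneg[where F = "\<lambda>t. - D t"
          and F' = "\<lambda>t. - (action_density h u v t + q t - \<kappa>^2 / 2 - h t / 4)"])
      fix t assume t: "e \<le> t" "t \<le> l"
      have "((\<lambda>t. \<kappa> * t) has_real_derivative \<kappa>) (at t)" by (auto intro!: derivative_eq_intros)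
      from calibration_deriv[OF _ this] have q: "(c has_real_derivative q t) (at t)"
        using t e by (simp add: q_def c_def[abs_def])
      show "((\<lambda>t. - D t) has_real_derivative - (action_density h u v t + q t - \<kappa>^2 / 2 - h t / 4)) (at t)"
        unfolding D_def by (rule DERIV_minus) (auto intro!: derivative_eq_intros q G K)
      have "\<kappa> * t \<le> \<kappa> * l" using t assms by (intro mult_left_mono) auto
      hence w: "0 \<le> \<kappa> * t" "\<kappa> * t \<le> 1" using assms t e by (auto intro: mult_nonneg_nonneg)
      have "(1 - (\<kappa> * t)^2)^2 \<le> 1" using w by (intro power_le_one) (auto simp: power_le_one)
      hence "h t * (1 - (\<kappa> * t)^2)^2 \<le> h t * 1" using h_pos[of t] by (intro mult_left_mono) auto
      moreover have "action_density h u v t + q t \<le> \<kappa>^2 / 2 + h t * (1 - (\<kappa> * t)^2)^2 / 4"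
        unfolding action_density_def q_def
        by (rule picone_inequality) (use u_pos[of t] h_pos[of t] t e in auto)
      ultimately show "0 \<le> - (action_density h u v t + q t - \<kappa>^2 / 2 - h t / 4)" by linarith
    qed (use e in auto)
    thus ?thesis by simp
  qed
  have D_le: "D e \<le> G e + \<kappa>^2 * e / 2 - K e / 4" if e: "0 < e" "e \<le> l" for e
  proof -
    have "v e * (\<kappa> * e)^2 / u e = (\<kappa>^2 * e) * (e * v e / u e)" by (simp add: power2_eq_square)
    also have "\<dots> \<le> (\<kappa>^2 * e) * 1" using u_ge_slope[of e] u_pos[of e] e
      by (intro mult_left_mono) auto
    finally have "v e * (\<kappa> * e)^2 / u e \<le> \<kappa>^2 * e" by simp
    moreover have "0 \<le> v e * u e" using v_ge0[of e] u_ge0[of e] e by simp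
    moreover have "0 \<le> \<kappa>^2 * e" using e by simp
    moreover have "D e = G e + (A - B) / 2 - C / 2 - K e / 4"
      if "A = v e * (\<kappa> * e)^2 / u e" "B = v e * u e" "C = \<kappa>^2 * e" for A B C
      unfolding that by (simp add: D_def c_def right_diff_distrib)
    ultimately have "D e \<le> G e + C / 2 - K e / 4" if "C = \<kappa>^2 * e" for C
      using that by fastforce
    thus ?thesis by simp
  qed
  have "((\<lambda>e. G e + \<kappa>^2 * e / 2 - K e / 4) \<longlongrightarrow> G 0 + \<kappa>^2 * 0 / 2 - K 0 / 4) (at_right 0)"
    by (intro tendsto_intros isCont_tendsto_compose[of 0 G] isCont_tendsto_compose[of 0 K]
        DERIV_isCont[OF G(1)] DERIV_isCont[OF K]) auto
  hence D0: "D l \<le> G 0 + \<kappa>^2 * 0 / 2 - K 0 / 4"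
  proof (rule tendsto_lowerbound)
    show "eventually (\<lambda>e. D l \<le> G e + \<kappa>^2 * e / 2 - K e / 4) (at_right 0)"
      using eventually_at_right_less[of 0] eventually_at_right_real[OF assms(1)]
      by eventually_elim (use D_anti D_le in force)
  qed simp
  have int: "integral {0..l} h = K l"
    using integral_antiderivative[OF K] assms by (simp add: K_def max_def)
  have "D l \<le> 0" using D0 by (simp add: G(3) K_def)
  hence "G l + c l \<le> \<kappa>^2 * l / 2 + K l / 4" unfolding D_def by linarith
  thus ?thesis using G(2)[of l] assms by (simp only: int c_def less_imp_le)
qed

end

text \<open>The competitor for the kink \<open>(u, v)\<close> is the straight line from its zero to the point \<open>(l, x \<delta>)\<close>, followed by the
kink \<open>(x, z)\<close> from time \<open>\<delta>\<close> on. The boundary term of the calibration vanishes at infinity.\<close>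

lemma kink_comparison:
  assumes "half_kink h \<alpha> \<beta> u v" "half_kink k \<alpha> \<beta> x z"
    and "0 < l" "0 < \<delta>" and shift: "\<And>t. 0 \<le> t \<Longrightarrow> h (l + t) = k (\<delta> + t)"
  shows "total_action h u v
    \<le> total_action k x z - action k x z \<delta> + (x \<delta>)^2 / (2 * l) + integral {0..l} h / 4"
proof -
  interpret A: half_kink h \<alpha> \<beta> u v by fact
  interpret B: half_kink k \<alpha> \<beta> x z by fact
  obtain G where G: "\<And>t. (G has_real_derivative action_density h u v t) (at t)"
    "\<And>R. 0 \<le> R \<Longrightarrow> action h u v R = G R" "G 0 = 0"
    using A.action_antiderivative by blast
  obtain K where K: "\<And>t. (K has_real_derivative action_density k x z t) (at t)"
    "\<And>R. 0 \<le> R \<Longrightarrow> action k x z R = K R" "K 0 = 0"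
    using B.action_antiderivative by blast
  define w where "w t = x (t - l + \<delta>)" for t
  define w' where "w' t = z (t - l + \<delta>)" for t
  have shift_deriv: "((\<lambda>t. t - l + \<delta>) has_real_derivative 1) (at t)" for t
    by (auto intro!: derivative_eq_intros)
  have dw: "(w has_real_derivative w' t) (at t)" for t
    unfolding w_def w'_def using DERIV_chain2[OF B.du shift_deriv] by simp
  define c where "c t = v t * ((w t)^2 / u t - u t) / 2" for t
  define c' where "c' t = (h t * ((u t)^3 - u t) * ((w t)^2 / u t - u t)
      + v t * (2 * w t * w' t / u t - (w t)^2 * v t / (u t)^2 - v t)) / 2" for t
  have dc: "(c has_real_derivative c' t) (at t)" if "0 < t" for t
    unfolding c_def c'_def by (rule A.calibration_deriv[OF that dw])
  have step: "action h u v R + c R - action k x z (R - l + \<delta>) \<le> action h u v l + c l - action k x z \<delta>"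
    if "l \<le> R" for R
  proof -
    have "- (G l + c l - K (l - l + \<delta>)) \<le> - (G R + c R - K (R - l + \<delta>))"
    proof (rule le_of_deriv_nonneg[where F = "\<lambda>t. - (G t + c t - K (t - l + \<delta>))"
          and F' = "\<lambda>t. - (action_density h u v t + c' t - action_density k x z (t - l + \<delta>))"])
      fix t assume t: "l \<le> t"
      have "((\<lambda>t. K (t - l + \<delta>)) has_real_derivative action_density k x z (t - l + \<delta>)) (at t)"
        using DERIV_chain2[OF K(1) shift_deriv] by simp
      thus "((\<lambda>t. - (G t + c t - K (t - l + \<delta>))) has_real_derivative
          - (action_density h u v t + c' t - action_density k x z (t - l + \<delta>))) (at t)"
        using t assms by (intro DERIV_minus DERIV_diff DERIV_add G dc) auto
      have "h t = k (t - l + \<delta>)" using shift[of "t - l"] t by (simp add: add.commute)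
      hence "action_density k x z (t - l + \<delta>) = (w' t)^2 / 2 + h t * (1 - (w t)^2)^2 / 4"
        by (simp add: action_density_def w_def w'_def)
      moreover have "action_density h u v t + c' t \<le> (w' t)^2 / 2 + h t * (1 - (w t)^2)^2 / 4"
        unfolding action_density_def c'_def
        by (rule picone_inequality) (use A.u_pos[of t] A.h_pos[of t] t assms in auto)
      ultimately show "0 \<le> - (action_density h u v t + c' t - action_density k x z (t - l + \<delta>))"
        by linarith
    qed fact
    thus ?thesis using that assms G(2) K(2) by simp
  qed
  have "total_action h u v + 0 * (1^2 / 1 - 1) / 2 - total_action k x z
      \<le> action h u v l + c l - action k x z \<delta>"
  proof (rule tendsto_upperbound)
    have shift_top: "filterlim (\<lambda>R::real. R - l + \<delta>) at_top at_top"
      by (rule filterlim_at_top_mono[OF filterlim_tendsto_add_at_top[OF tendsto_const[of "\<delta> - l"] filterlim_ident]])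
        auto
    have w_lim: "(w \<longlongrightarrow> 1) at_top" unfolding w_def
      by (rule filterlim_compose[OF B.u_tendsto shift_top])
    have a_lim: "((\<lambda>R. action k x z (R - l + \<delta>)) \<longlongrightarrow> total_action k x z) at_top"
      by (rule filterlim_compose[OF B.action_tendsto shift_top])
    show "((\<lambda>R. action h u v R + c R - action k x z (R - l + \<delta>)) \<longlongrightarrow>
        total_action h u v + 0 * (1^2 / 1 - 1) / 2 - total_action k x z) at_top"
      unfolding c_def
      by (intro tendsto_intros A.action_tendsto a_lim w_lim A.v_tendsto A.u_tendsto) auto
    show "eventually (\<lambda>R. action h u v R + c R - action k x z (R - l + \<delta>)
        \<le> action h u v l + c l - action k x z \<delta>) at_top"
      using eventually_ge_at_top[of l] by eventually_elim (rule step)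
  qed simp
  moreover have "action h u v l + c l \<le> (x \<delta> / l)^2 * l / 2 + integral {0..l} h / 4"
    using A.line_comparison[OF \<open>0 < l\<close>, of "x \<delta> / l"] B.u_ge0[of \<delta>] B.u_le1[of \<delta>] assms
    by (simp add: c_def w_def)
  moreover have "(x \<delta> / l)^2 * l / 2 = (x \<delta>)^2 / (2 * l)" using \<open>0 < l\<close>
    by (simp add: power2_eq_square)
  ultimately show ?thesis by linarith
qed

section \<open>Minimising over the position of the zero\<close>

context half_kink
begin

text \<open>The kinetic part is at least that of the chord (Cauchy-Schwarz, in the pointwise form \<open>v\<^sup>2/2 \<ge> m v - m\<^sup>2/2\<close>), and the
potential part differs from \<open>h / 4\<close> by \<open>O(\<delta>\<^sup>2)\<close> because \<open>u\<close> is small there.\<close>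

lemma action_lower:
  assumes "0 < \<delta>"
  shows "(u \<delta>)^2 / (2 * \<delta>) + integral {0..\<delta>} h / 4 - \<beta>^2 * \<delta>^3 / 4 \<le> action h u v \<delta>"
proof -
  obtain G where G: "\<And>t. (G has_real_derivative action_density h u v t) (at t)"
    "\<And>R. 0 \<le> R \<Longrightarrow> action h u v R = G R" "G 0 = 0"
    using action_antiderivative by blast
  obtain K0 where K0: "\<And>t. (K0 has_real_derivative h t) (at t)"
    using real_antiderivative_exists[OF h_cont] by blast
  define K where "K t = K0 t - K0 0" for t
  have K: "(K has_real_derivative h t) (at t)" for t
    unfolding K_def using DERIV_diff[OF K0 DERIV_const] by simp
  define m where "m = u \<delta> / \<delta>"
  define F where "F t = G t - (m * u t - m^2 / 2 * t + K t / 4 - \<beta>^2 * \<delta>^2 / 4 * t)" for t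
  define F' where "F' t = action_density h u v t - (m * v t - m^2 / 2 + h t / 4 - \<beta>^2 * \<delta>^2 / 4)" for t
  have "F 0 \<le> F \<delta>"
  proof (rule le_of_deriv_nonneg[where F = F and F' = F'])
    fix t assume t: "0 \<le> t" "t \<le> \<delta>"
    show "(F has_real_derivative F' t) (at t)"
      unfolding F_def F'_def by (auto intro!: derivative_eq_intros G K du)
    have "u t \<le> v 0 * t" by (rule u_le_linear[OF t(1)])
    also have "\<dots> \<le> sqrt (\<beta> / 2) * \<delta>" using v0_bounds v0_pos t \<beta>_pos by (intro mult_mono) auto
    finally have "(u t)^2 \<le> (sqrt (\<beta> / 2) * \<delta>)^2" using u_ge0[OF t(1)] by (intro power_mono)
    hence u2: "(u t)^2 \<le> \<beta> / 2 * \<delta>^2" using \<beta>_pos by (simp add: power_mult_distrib)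
    have "h t * (2 * (u t)^2 - (u t)^4) \<le> \<beta> * (2 * (u t)^2)"
    proof -
      have "h t * (2 * (u t)^2 - (u t)^4) \<le> h t * (2 * (u t)^2)"
        using h_pos[of t] by (intro mult_left_mono) auto
      also have "\<dots> \<le> \<beta> * (2 * (u t)^2)" using h_le[of t] by (intro mult_right_mono) auto
      finally show ?thesis .
    qed
    also have "\<dots> \<le> \<beta> * (2 * (\<beta> / 2 * \<delta>^2))" using u2 \<beta>_pos by (intro mult_left_mono) auto
    also have "\<dots> = \<beta>^2 * \<delta>^2" by (simp add: power2_eq_square)
    finally have "h t * (2 * (u t)^2 - (u t)^4) \<le> \<beta>^2 * \<delta>^2" .
    moreover have "F' t = (v t - m)^2 / 2 + (\<beta>^2 * \<delta>^2 - h t * (2 * (u t)^2 - (u t)^4)) / 4"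
      unfolding F'_def action_density_def
      by (simp add: field_simps power2_eq_square power4_eq_xxxx)
    ultimately show "0 \<le> F' t" by simp
  qed (use assms in auto)
  moreover have "F 0 = 0" by (simp add: F_def G(3) K_def)
  moreover have "F \<delta> = G \<delta> - ((u \<delta>)^2 / (2 * \<delta>) + K \<delta> / 4 - \<beta>^2 * \<delta>^3 / 4)"
    using assms by (simp add: F_def m_def field_simps power2_eq_square power3_eq_cube)
  moreover have "integral {0..\<delta>} h = K \<delta>"
    using integral_antiderivative[OF K] assms by (simp add: K_def max_def)
  ultimately show ?thesis using G(2)[of \<delta>] assms by simp
qed

lemma slope_tendsto: "((\<lambda>\<delta>. u \<delta> / \<delta>) \<longlongrightarrow> v 0) (at_right 0)"
proof -
  have "((\<lambda>\<delta>. (u (0 + \<delta>) - u 0) / \<delta>) \<longlongrightarrow> v 0) (at 0)"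
    using du[of 0] by (simp only: DERIV_def)
  thus ?thesis by (auto intro: tendsto_within_subset simp: tendsto_mono[OF at_le])
qed

end

context pinched
begin

lemma pinched_right: "pinched (\<lambda>t. h (s + t)) \<alpha> \<beta>"
  and pinched_left: "pinched (\<lambda>t. h (s - t)) \<alpha> \<beta>"
  by (unfold_locales; (intro continuous_on_compose2[OF h_cont] continuous_intros \<alpha>_pos h_ge h_le)?; simp)+

text \<open>The chord argument. Here \<open>u \<delta> - x \<delta>\<close> is about \<open>\<delta>\<close> times the jump of the derivative at \<open>s\<close>, so the left-hand
side is the kinetic action that the chord saves. The remaining errors are of order \<open>\<delta>\<^sup>3\<close>, because the integrals of
\<open>h / 4\<close> along the two halves of the chord cancel against those along the kinks.\<close>

lemma corner_estimate:
  assumes "half_kink (\<lambda>t. h (s + t)) \<alpha> \<beta> u v" "half_kink (\<lambda>t. h (s - t)) \<alpha> \<beta> x z" and "0 < \<delta>"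
    and I: "\<And>s u v x z. kink (\<lambda>t. h (s + t)) u v \<Longrightarrow> kink (\<lambda>t. h (s - t)) x z \<Longrightarrow>
      I \<le> total_action (\<lambda>t. h (s + t)) u v + total_action (\<lambda>t. h (s - t)) x z"
  shows "(u \<delta> - x \<delta>)^2 / (4 * \<delta>)
    \<le> total_action (\<lambda>t. h (s + t)) u v + total_action (\<lambda>t. h (s - t)) x z - I + \<beta>^2 * \<delta>^3 / 2"
proof -
  interpret A: half_kink "\<lambda>t. h (s + t)" \<alpha> \<beta> u v by fact
  interpret B: half_kink "\<lambda>t. h (s - t)" \<alpha> \<beta> x z by fact
  obtain H where H: "\<And>t. (H has_real_derivative h t) (at t)"
    using real_antiderivative_exists[OF h_cont] by blast
  have right_int: "integral {0..l} (\<lambda>t. h (r + t)) = H (r + l) - H r" if "0 \<le> l" for r l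
  proof -
    have d: "((\<lambda>t. r + t) has_real_derivative 1) (at t)" for t by (auto intro!: derivative_eq_intros)
    have "((\<lambda>t. H (r + t)) has_real_derivative h (r + t)) (at t)" for t
      using DERIV_chain2[OF H d] by simp
    thus ?thesis by (subst integral_antiderivative[where G = "\<lambda>t. H (r + t)"])
      (use that in \<open>auto simp: max_def\<close>)
  qed
  have left_int: "integral {0..l} (\<lambda>t. h (r - t)) = H r - H (r - l)" if "0 \<le> l" for r l
  proof -
    have d: "((\<lambda>t. r - t) has_real_derivative - 1) (at t)" for t by (auto intro!: derivative_eq_intros)
    have "((\<lambda>t. - H (r - t)) has_real_derivative h (r - t)) (at t)" for t
      using DERIV_minus[OF DERIV_chain2[OF H d]] by simp
    thus ?thesis by (subst integral_antiderivative[where G = "\<lambda>t. - H (r - t)"])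
      (use that in \<open>auto simp: max_def\<close>)
  qed
  define a b where "a = u \<delta>" and "b = x \<delta>"
  have ab: "0 < a" "0 < b" using A.u_pos B.u_pos \<open>0 < \<delta>\<close> by (auto simp: a_def b_def)
  \<comment> \<open>The chord from \<open>(s - \<delta>, - b)\<close> to \<open>(s + \<delta>, a)\<close> vanishes at \<open>s + \<delta> - l = s - \<delta> + l'\<close>.\<close>
  define l l' where "l = 2 * \<delta> * a / (a + b)" and "l' = 2 * \<delta> * b / (a + b)"
  have l: "0 < l" "0 < l'" using ab \<open>0 < \<delta>\<close> by (auto simp: l_def l'_def)
  have ll: "l + l' = 2 * \<delta>" using ab
    by (simp add: l_def l'_def add_divide_distrib[symmetric] distrib_left[symmetric])
  define r where "r = s + \<delta> - l"
  have r': "r = s - \<delta> + l'" using ll by (simp add: r_def)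
  obtain u' v' where k1: "kink (\<lambda>t. h (r + t)) u' v'"
    using pinched.kink_exists[OF pinched_right] by blast
  obtain x' z' where k2: "kink (\<lambda>t. h (r - t)) x' z'"
    using pinched.kink_exists[OF pinched_left] by blast
  have hk1: "half_kink (\<lambda>t. h (r + t)) \<alpha> \<beta> u' v'"
    using k1 pinched_right by (simp add: half_kink_def half_kink_axioms_def)
  have hk2: "half_kink (\<lambda>t. h (r - t)) \<alpha> \<beta> x' z'"
    using k2 pinched_left by (simp add: half_kink_def half_kink_axioms_def)
  have shift: "h (r + (l + t)) = h (s + (\<delta> + t))" "h (r - (l' + t)) = h (s - (\<delta> + t))" for t
  proof -
    have "r + (l + t) = s + (\<delta> + t)" "r - (l' + t) = s - (\<delta> + t)" using r_def r' by linarith+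
    thus "h (r + (l + t)) = h (s + (\<delta> + t))" "h (r - (l' + t)) = h (s - (\<delta> + t))" by (simp_all only:)
  qed
  have "total_action (\<lambda>t. h (r + t)) u' v' \<le> total_action (\<lambda>t. h (s + t)) u v
      - action (\<lambda>t. h (s + t)) u v \<delta> + a^2 / (2 * l) + (H (r + l) - H r) / 4"
    using kink_comparison[OF hk1 assms(1) l(1) \<open>0 < \<delta>\<close> shift(1)] l right_int[of l r]
    by (simp add: a_def)
  moreover have "total_action (\<lambda>t. h (r - t)) x' z' \<le> total_action (\<lambda>t. h (s - t)) x z
      - action (\<lambda>t. h (s - t)) x z \<delta> + b^2 / (2 * l') + (H r - H (r - l')) / 4"
    using kink_comparison[OF hk2 assms(2) l(2) \<open>0 < \<delta>\<close> shift(2)] l left_int[of l' r]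
    by (simp add: b_def)
  moreover have "a^2 / (2 * \<delta>) + (H (s + \<delta>) - H s) / 4 - \<beta>^2 * \<delta>^3 / 4 \<le> action (\<lambda>t. h (s + t)) u v \<delta>"
    using A.action_lower[OF \<open>0 < \<delta>\<close>] \<open>0 < \<delta>\<close> by (simp add: a_def right_int)
  moreover have "b^2 / (2 * \<delta>) + (H s - H (s - \<delta>)) / 4 - \<beta>^2 * \<delta>^3 / 4 \<le> action (\<lambda>t. h (s - t)) x z \<delta>"
    using B.action_lower[OF \<open>0 < \<delta>\<close>] \<open>0 < \<delta>\<close> by (simp add: b_def left_int)
  moreover have "r + l = s + \<delta>" "r - l' = s - \<delta>" using r_def r' by linarith+
  moreover have "a^2 / (2 * l) + b^2 / (2 * l') = a^2 / (2 * \<delta>) + b^2 / (2 * \<delta>) - (a - b)^2 / (4 * \<delta>)"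
    using ab \<open>0 < \<delta>\<close> by (simp add: l_def l'_def field_simps power2_eq_square)
  moreover note I[OF k1 k2]
  ultimately show ?thesis unfolding a_def[symmetric] b_def[symmetric]
    by (simp add: diff_divide_distrib)
qed

end

text \<open>Kinks form a closed set: the limiting initial data define a clamped trajectory, to which the kinks converge pointwise by
\<open>clamped_flow_stability\<close>. The uniform lower bound on the slope keeps the limit nontrivial.\<close>

lemma kink_limit:
  assumes kinks: "\<And>n. half_kink (k n) \<alpha> \<beta> (u n) (v n)" and lim: "pinched k' \<alpha> \<beta>"
    and unif: "\<And>\<tau> e. 0 < e \<Longrightarrow> eventually (\<lambda>n. \<forall>t\<in>{0..\<tau>}. \<bar>k n t - k' t\<bar> \<le> e) sequentially"
    and slope: "(\<lambda>n. v n 0) \<longlonglongrightarrow> m"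
  obtains u' v' where "half_kink k' \<alpha> \<beta> u' v'" "v' 0 = m"
    "\<And>t. 0 \<le> t \<Longrightarrow> (\<lambda>n. u n t) \<longlonglongrightarrow> u' t"
proof -
  interpret L: pinched k' \<alpha> \<beta> by fact
  have "sqrt (\<alpha> / 2) \<le> m"
    by (rule LIMSEQ_le_const[OF slope]) (use half_kink.v0_bounds(1)[OF kinks] in auto)
  moreover have "0 < sqrt (\<alpha> / 2)" using L.\<alpha>_pos by simp
  ultimately have m: "0 < m" by linarith
  obtain u' v' where f: "u' 0 = 0" "v' 0 = m" "\<And>t. (u' has_real_derivative v' t) (at t)"
    "\<And>t. (v' has_real_derivative k' t * clamped_cubic (u' t)) (at t)"
    using clamped_ivp_exists[OF L.h_cont L.h_abs L.\<beta>_pos, of m] m by auto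
  have conv: "(\<lambda>n. (u n t - u' t)^2 + (v n t - v' t)^2) \<longlonglongrightarrow> 0" if t: "0 \<le> t" for t
  proof (rule LIMSEQ_I)
    fix e :: real assume e: "0 < e"
    define E where "E = exp ((2 + 2 * \<beta>) * (t - 0))"
    have E: "0 < E" by (simp add: E_def)
    define d where "d = sqrt (e / (2 * E * (t + 1)))"
    have d: "0 < d" "d^2 = e / (2 * E * (t + 1))" using e E t by (auto simp: d_def)
    have "E * (d^2 * t) = e / 2 * (t / (t + 1))" using E t by (simp add: d)
    also have "\<dots> < e / 2 * 1" using e t by (intro mult_strict_left_mono) auto
    finally have Ed: "E * (d^2 * t) < e / 2" by simp
    have "(\<lambda>n. E * (v n 0 - m)^2) \<longlonglongrightarrow> E * (m - m)^2" by (intro tendsto_intros slope)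
    hence "eventually (\<lambda>n. E * (v n 0 - m)^2 < e / 2) sequentially"
      by (rule order_tendstoD) (use e in auto)
    hence "eventually (\<lambda>n. (u n t - u' t)^2 + (v n t - v' t)^2 < e) sequentially"
      using unif[OF d(1), of t]
    proof eventually_elim
      case (elim n)
      interpret K: half_kink "k n" \<alpha> \<beta> "u n" "v n" by (rule kinks)
      have "(u n t - u' t)^2 + (v n t - v' t)^2
          \<le> E * ((u n 0 - u' 0)^2 + (v n 0 - v' 0)^2 + d^2 * (t - 0))"
        unfolding E_def
        by (rule clamped_flow_stability[where h = "k n" and k = k'])
          (use K.du K.dv f L.h_abs elim t d in auto)
      also have "\<dots> = E * (v n 0 - m)^2 + E * (d^2 * t)" by (simp add: f algebra_simps)
      also have "\<dots> < e" using elim Ed by linarith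
      finally show ?case .
    qed
    thus "\<exists>N. \<forall>n\<ge>N. norm ((u n t - u' t)^2 + (v n t - v' t)^2 - 0) < e"
      by (simp add: eventually_sequentially)
  qed
  have u_lim: "(\<lambda>n. u n t) \<longlonglongrightarrow> u' t" and v_lim: "(\<lambda>n. v n t) \<longlonglongrightarrow> v' t" if t: "0 \<le> t" for t
  proof -
    have "(\<lambda>n. (u n t - u' t)^2) \<longlonglongrightarrow> 0" "(\<lambda>n. (v n t - v' t)^2) \<longlonglongrightarrow> 0"
      by (rule tendsto_sandwich[OF _ _ tendsto_const conv[OF t]]; simp)+
    from this[THEN tendsto_real_sqrt]
    show "(\<lambda>n. u n t) \<longlonglongrightarrow> u' t" "(\<lambda>n. v n t) \<longlonglongrightarrow> v' t"
      by (simp_all add: tendsto_rabs_zero_iff LIM_zero_iff)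
  qed
  have "u' t \<le> 1" if "0 \<le> t" for t
    by (rule LIMSEQ_le_const2[OF u_lim[OF that]]) (use half_kink.u_le1[OF kinks that] in auto)
  moreover have "0 \<le> v' t" if "0 \<le> t" for t
    by (rule LIMSEQ_le_const[OF v_lim[OF that]]) (use half_kink.v_ge0[OF kinks that] in auto)
  ultimately have "kink k' u' v'" using f m by (auto simp: kink_def)
  hence "half_kink k' \<alpha> \<beta> u' v'" using lim by (simp add: half_kink_def half_kink_axioms_def)
  thus thesis using that f u_lim by blast
qed

locale periodic_pinched = pinched +
  fixes P :: real
  assumes P_pos: "0 < P" and h_periodic: "h (t + P) = h t"
begin

lemma h_periodic_int: "h (t + of_int n * P) = h t"
proof -
  have nat: "h (t + real n * P) = h t" for n t
  proof (induction n)
    case (Suc n)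
    have "h (t + real (Suc n) * P) = h ((t + real n * P) + P)" by (simp add: algebra_simps)
    with Suc show ?case by (simp add: h_periodic)
  qed simp
  show ?thesis
  proof (cases "0 \<le> n")
    case True
    then show ?thesis using nat[of t "nat n"] by simp
  next
    case False
    then show ?thesis using nat[of "t + of_int n * P" "nat (- n)"] by simp
  qed
qed

lemma shift_uniform:
  assumes "s \<longlonglongrightarrow> s'" "\<And>n. s n \<in> {0..P}" "s' \<in> {0..P}" "0 < e"
  shows "eventually (\<lambda>n. \<forall>t\<in>{0..\<tau>}. \<bar>h (s n + t) - h (s' + t)\<bar> \<le> e) sequentially"
    and "eventually (\<lambda>n. \<forall>t\<in>{0..\<tau>}. \<bar>h (s n - t) - h (s' - t)\<bar> \<le> e) sequentially"
proof -
  have "uniformly_continuous_on {-\<tau>..P + \<tau>} h"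
    by (intro compact_uniformly_continuous continuous_on_subset[OF h_cont]) auto
  then obtain d where d: "0 < d"
    "\<And>x y. x \<in> {-\<tau>..P + \<tau>} \<Longrightarrow> y \<in> {-\<tau>..P + \<tau>} \<Longrightarrow> dist y x < d \<Longrightarrow> dist (h y) (h x) < e"
    using \<open>0 < e\<close> unfolding uniformly_continuous_on_def by metis
  have ev: "eventually (\<lambda>n. dist (s n) s' < d) sequentially" by (rule tendstoD[OF assms(1) d(1)])
  show "eventually (\<lambda>n. \<forall>t\<in>{0..\<tau>}. \<bar>h (s n + t) - h (s' + t)\<bar> \<le> e) sequentially"
    using ev
  proof eventually_elim
    case (elim n)
    show ?case
    proof
      fix t assume "t \<in> {0..\<tau>}"
      hence "dist (h (s n + t)) (h (s' + t)) < e"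
        using assms(2)[of n] assms(3) elim by (intro d) (auto simp: dist_real_def)
      thus "\<bar>h (s n + t) - h (s' + t)\<bar> \<le> e" by (simp add: dist_real_def)
    qed
  qed
  show "eventually (\<lambda>n. \<forall>t\<in>{0..\<tau>}. \<bar>h (s n - t) - h (s' - t)\<bar> \<le> e) sequentially"
    using ev
  proof eventually_elim
    case (elim n)
    show ?case
    proof
      fix t assume "t \<in> {0..\<tau>}"
      hence "dist (h (s n - t)) (h (s' - t)) < e"
        using assms(2)[of n] assms(3) elim by (intro d) (auto simp: dist_real_def)
      thus "\<bar>h (s n - t) - h (s' - t)\<bar> \<le> e" by (simp add: dist_real_def)
    qed
  qed
qed

text \<open>Along a sequence of positions whose action tends to the infimum, the corner estimate in the limit reads
\<open>(u' \<delta> / \<delta> - x' \<delta> / \<delta>)\<^sup>2 \<le> 2 \<beta>\<^sup>2 \<delta>\<^sup>2\<close>; letting \<open>\<delta>\<close> tend to \<open>0\<close> equates the two slopes.\<close>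

lemma matching_kinks_exist:
  "\<exists>s u v x z. half_kink (\<lambda>t. h (s + t)) \<alpha> \<beta> u v \<and> half_kink (\<lambda>t. h (s - t)) \<alpha> \<beta> x z \<and> v 0 = z 0"
proof -
  define W where "W s u v x z = total_action (\<lambda>t. h (s + t)) u v + total_action (\<lambda>t. h (s - t)) x z"
    for s u v x z
  define S where "S = {w. \<exists>s u v x z. kink (\<lambda>t. h (s + t)) u v \<and> kink (\<lambda>t. h (s - t)) x z \<and> w = W s u v x z}"
  have hkr: "half_kink (\<lambda>t. h (s + t)) \<alpha> \<beta> u v" if "kink (\<lambda>t. h (s + t)) u v" for s u v
    using that pinched_right by (simp add: half_kink_def half_kink_axioms_def)
  have hkl: "half_kink (\<lambda>t. h (s - t)) \<alpha> \<beta> u v" if "kink (\<lambda>t. h (s - t)) u v" for s u v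
    using that pinched_left by (simp add: half_kink_def half_kink_axioms_def)
  have "S \<noteq> {}" using pinched.kink_exists[OF pinched_right[of 0]] pinched.kink_exists[OF pinched_left[of 0]]
    unfolding S_def by blast
  moreover have "bdd_below S"
    by (rule bdd_belowI[of _ 0])
      (auto simp: S_def W_def intro!: add_nonneg_nonneg half_kink.total_action_nonneg hkr hkl)
  ultimately have Inf_le: "w \<in> S \<Longrightarrow> Inf S \<le> w" and Inf_less: "Inf S < y \<Longrightarrow> \<exists>w\<in>S. w < y" for w y
    by (auto intro: cInf_lower simp: cInf_less_iff)
  have "\<exists>s u v x z. s \<in> {0..P} \<and> kink (\<lambda>t. h (s + t)) u v \<and> kink (\<lambda>t. h (s - t)) x z
      \<and> W s u v x z < Inf S + 1 / real (Suc n)" for n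
  proof -
    have "Inf S < Inf S + 1 / real (Suc n)" by simp
    from Inf_less[OF this] obtain s u v x z where k: "kink (\<lambda>t. h (s + t)) u v" "kink (\<lambda>t. h (s - t)) x z"
      "W s u v x z < Inf S + 1 / real (Suc n)" unfolding S_def by blast
    \<comment> \<open>A shift by a multiple of the period brings the zero into \<open>{0..P}\<close> and leaves the kinks unchanged.\<close>
    define q where "q = - \<lfloor>s / P\<rfloor>"
    have "h (s + of_int q * P + t) = h (s + t)" "h (s + of_int q * P - t) = h (s - t)" for t
      using h_periodic_int[of "s + t" q] h_periodic_int[of "s - t" q] by (simp_all add: algebra_simps)
    moreover have "s + of_int q * P \<in> {0..P}"
    proof -
      have "of_int \<lfloor>s / P\<rfloor> * P \<le> s" "s < (of_int \<lfloor>s / P\<rfloor> + 1) * P"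
        using floor_divide_lower[OF P_pos, of s] floor_divide_upper[OF P_pos, of s] by auto
      thus ?thesis by (simp add: q_def algebra_simps)
    qed
    ultimately show ?thesis using k unfolding W_def
      by (intro exI[of _ "s + of_int q * P"] exI[of _ u] exI[of _ v] exI[of _ x] exI[of _ z]) simp
  qed
  then obtain s u v x z where s: "\<And>n. s n \<in> {0..P}"
    and kr: "\<And>n. kink (\<lambda>t. h (s n + t)) (u n) (v n)" and kl: "\<And>n. kink (\<lambda>t. h (s n - t)) (x n) (z n)"
    and W: "\<And>n. W (s n) (u n) (v n) (x n) (z n) < Inf S + 1 / real (Suc n)"
    by metis
  define Q where "Q = {0..P} \<times> {sqrt (\<alpha> / 2)..sqrt (\<beta> / 2)} \<times> {sqrt (\<alpha> / 2)..sqrt (\<beta> / 2)}"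
  have "compact Q" unfolding Q_def by (intro compact_Times) auto
  moreover have "(s n, v n 0, z n 0) \<in> Q" for n
    using s half_kink.v0_bounds[OF hkr[OF kr[of n]]] half_kink.v0_bounds[OF hkl[OF kl[of n]]]
    by (auto simp: Q_def)
  ultimately obtain l r where l: "l \<in> Q" and r: "strict_mono (r :: nat \<Rightarrow> nat)"
    and lim: "((\<lambda>n. (s n, v n 0, z n 0)) \<circ> r) \<longlonglongrightarrow> l"
    unfolding compact_def by (metis (no_types, lifting))
  obtain s' m1 m2 where l_eq: "l = (s', m1, m2)" by (cases l) auto
  have s': "s' \<in> {0..P}" using l by (simp add: l_eq Q_def)
  have lims: "(\<lambda>n. s (r n)) \<longlonglongrightarrow> s'" "(\<lambda>n. v (r n) 0) \<longlonglongrightarrow> m1" "(\<lambda>n. z (r n) 0) \<longlonglongrightarrow> m2"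
    using tendsto_fst[OF lim] tendsto_fst[OF tendsto_snd[OF lim]] tendsto_snd[OF tendsto_snd[OF lim]]
    by (simp_all add: l_eq o_def)
  obtain u' v' where A: "half_kink (\<lambda>t. h (s' + t)) \<alpha> \<beta> u' v'" "v' 0 = m1"
    "\<And>t. 0 \<le> t \<Longrightarrow> (\<lambda>n. u (r n) t) \<longlonglongrightarrow> u' t"
    using kink_limit[of "\<lambda>n t. h (s (r n) + t)" \<alpha> \<beta> "\<lambda>n. u (r n)" "\<lambda>n. v (r n)" "\<lambda>t. h (s' + t)" m1,
        OF hkr[OF kr] pinched_right shift_uniform(1)[OF lims(1) s s'] lims(2)] by blast
  obtain x' z' where B: "half_kink (\<lambda>t. h (s' - t)) \<alpha> \<beta> x' z'" "z' 0 = m2"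
    "\<And>t. 0 \<le> t \<Longrightarrow> (\<lambda>n. x (r n) t) \<longlonglongrightarrow> x' t"
    using kink_limit[of "\<lambda>n t. h (s (r n) - t)" \<alpha> \<beta> "\<lambda>n. x (r n)" "\<lambda>n. z (r n)" "\<lambda>t. h (s' - t)" m2,
        OF hkl[OF kl] pinched_left shift_uniform(2)[OF lims(1) s s'] lims(3)] by blast
  have corner: "(u' \<delta> - x' \<delta>)^2 / (4 * \<delta>) \<le> 0 + \<beta>^2 * \<delta>^3 / 2" if "0 < \<delta>" for \<delta>
  proof (rule tendsto_le[OF _ _ _ always_eventually])
    show "(\<lambda>n. 1 / real (Suc (r n)) + \<beta>^2 * \<delta>^3 / 2) \<longlonglongrightarrow> 0 + \<beta>^2 * \<delta>^3 / 2"
      using LIMSEQ_subseq_LIMSEQ[OF LIMSEQ_Suc[OF lim_1_over_n] r]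
      by (intro tendsto_intros) (simp add: o_def)
    show "(\<lambda>n. (u (r n) \<delta> - x (r n) \<delta>)^2 / (4 * \<delta>)) \<longlonglongrightarrow> (u' \<delta> - x' \<delta>)^2 / (4 * \<delta>)"
      using that by (intro tendsto_intros A B) auto
    show "\<forall>n. (u (r n) \<delta> - x (r n) \<delta>)^2 / (4 * \<delta>) \<le> 1 / real (Suc (r n)) + \<beta>^2 * \<delta>^3 / 2"
    proof
      fix n
      have "(u (r n) \<delta> - x (r n) \<delta>)^2 / (4 * \<delta>)
          \<le> W (s (r n)) (u (r n)) (v (r n)) (x (r n)) (z (r n)) - Inf S + \<beta>^2 * \<delta>^3 / 2"
        unfolding W_def
        by (rule corner_estimate[OF hkr[OF kr] hkl[OF kl] that])
          (rule Inf_le, simp only: S_def W_def, blast)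
      with W[of "r n"] show "(u (r n) \<delta> - x (r n) \<delta>)^2 / (4 * \<delta>) \<le> 1 / real (Suc (r n)) + \<beta>^2 * \<delta>^3 / 2"
        by linarith
    qed
  qed simp
  have est: "(u' \<delta> / \<delta> - x' \<delta> / \<delta>)^2 \<le> 2 * \<beta>^2 * \<delta>^2" if "0 < \<delta>" for \<delta>
  proof -
    have "(u' \<delta> / \<delta> - x' \<delta> / \<delta>)^2 = (u' \<delta> - x' \<delta>)^2 / (4 * \<delta>) * (4 / \<delta>)"
      using that by (simp add: diff_divide_distrib[symmetric] power_divide power2_eq_square[of \<delta>])
    also have "\<dots> \<le> (0 + \<beta>^2 * \<delta>^3 / 2) * (4 / \<delta>)"
      using that by (intro mult_right_mono corner) auto
    also have "\<dots> = 2 * \<beta>^2 * \<delta>^2" using that by (simp add: power2_eq_square power3_eq_cube)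
    finally show ?thesis .
  qed
  have "(m1 - m2)^2 \<le> 2 * \<beta>^2 * 0^2"
  proof (rule tendsto_le[OF trivial_limit_at_right_real])
    show "((\<lambda>\<delta>. (u' \<delta> / \<delta> - x' \<delta> / \<delta>)^2) \<longlongrightarrow> (m1 - m2)^2) (at_right (0::real))"
      using half_kink.slope_tendsto[OF A(1)] half_kink.slope_tendsto[OF B(1)]
      by (auto intro!: tendsto_intros simp: A(2) B(2))
    show "((\<lambda>\<delta>. 2 * \<beta>^2 * \<delta>^2) \<longlongrightarrow> 2 * \<beta>^2 * 0^2) (at_right (0::real))"
      by (intro tendsto_intros)
    show "eventually (\<lambda>\<delta>. (u' \<delta> / \<delta> - x' \<delta> / \<delta>)^2 \<le> 2 * \<beta>^2 * \<delta>^2) (at_right 0)"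
      using eventually_at_right_less[of 0] by eventually_elim (rule est)
  qed
  hence "v' 0 = z' 0" using A(2) B(2) by simp
  with A(1) B(1) show ?thesis
    by (intro exI[of _ s'] exI[of _ u'] exI[of _ v'] exI[of _ x'] exI[of _ z']) simp
qed

end

section \<open>The heteroclinic solution\<close>

lemma has_real_derivative_glue:
  fixes f g :: "real \<Rightarrow> real"
  assumes f: "\<And>x. (f has_real_derivative f' x) (at x)" and g: "\<And>x. (g has_real_derivative g' x) (at x)"
    and eq: "f s = g s" "f' s = g' s"
  shows "((\<lambda>x. if s \<le> x then f x else g x) has_real_derivative (if s \<le> x then f' x else g' x)) (at x)"
proof -
  define F where "F = (\<lambda>x. if s \<le> x then f x else g x)"
  consider "s < x" | "x < s" | "x = s" by linarith
  hence "(F has_real_derivative (if s \<le> x then f' x else g' x)) (at x)"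
  proof cases
    case 1
    have "(F has_real_derivative f' x) (at x)"
      by (rule has_field_derivative_transform_within_open[OF f[of x], of "{s<..}"]) (use 1 in \<open>auto simp: F_def\<close>)
    with 1 show ?thesis by simp
  next
    case 2
    have "(F has_real_derivative g' x) (at x)"
      by (rule has_field_derivative_transform_within_open[OF g[of x], of "{..<s}"]) (use 2 in \<open>auto simp: F_def\<close>)
    with 2 show ?thesis by simp
  next
    case 3
    have "((\<lambda>y. if s \<le> y then (f y - f s) / (y - s) else (g y - g s) / (y - s)) \<longlongrightarrow> f' s) (at s)"
      using f[of s] g[of s] eq
      by (intro filterlim_If) (auto simp: has_field_derivative_iff intro: tendsto_mono[OF inf_le1])
    also have "(\<lambda>y. if s \<le> y then (f y - f s) / (y - s) else (g y - g s) / (y - s)) = (\<lambda>y. (F y - F s) / (y - s))"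
      using eq by (auto simp: F_def)
    finally show ?thesis using 3 by (simp add: has_field_derivative_iff)
  qed
  thus ?thesis by (simp add: F_def)
qed

text \<open>The left half is the odd reflection of a kink for the reflected coefficient. The kink bounds are exponential in the
distance from the zero \<open>s\<close>; the factor \<open>exp (a |s|)\<close> in \<open>C\<close> recentres them at \<open>0\<close>.\<close>

lemma (in periodic_pinched) heteroclinic_exists:
  obtains U V C c where "0 < c" "0 < C"
    "\<And>t. (U has_real_derivative V t) (at t)"
    "\<And>t. (V has_real_derivative h t * (U t ^ 3 - U t)) (at t)"
    "\<And>t. 0 < V t" "\<And>t. V t \<le> C * exp (- c * \<bar>t\<bar>)"
    "\<And>t. \<bar>U t - 1\<bar> \<le> C * exp (- c * t)" "\<And>t. \<bar>U t + 1\<bar> \<le> C * exp (c * t)"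
proof -
  obtain s u v x z where A: "half_kink (\<lambda>t. h (s + t)) \<alpha> \<beta> u v"
    and B: "half_kink (\<lambda>t. h (s - t)) \<alpha> \<beta> x z" and m: "v 0 = z 0"
    using matching_kinks_exist by blast
  interpret A: half_kink "\<lambda>t. h (s + t)" \<alpha> \<beta> u v by fact
  interpret B: half_kink "\<lambda>t. h (s - t)" \<alpha> \<beta> x z by fact
  define U where "U t = (if s \<le> t then u (t - s) else - x (s - t))" for t
  define V where "V t = (if s \<le> t then v (t - s) else z (s - t))" for t
  define a b where "a = sqrt (\<alpha> / 2)" and "b = sqrt (\<beta> / 2)"
  have ab: "0 < a" "0 < b" using \<alpha>_pos \<beta>_pos by (auto simp: a_def b_def)
  \<comment> \<open>The summand 2 covers \<open>\<bar>U \<mp> 1\<bar>\<close> on the far side of \<open>s\<close>, the summand \<open>2 * b\<close> the derivative.\<close>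
  define C where "C = (2 + 2 * b) * exp (a * \<bar>s\<bar>)"
  have dr: "((\<lambda>t. t - s) has_real_derivative 1) (at t)" for t by (auto intro!: derivative_eq_intros)
  have dl: "((\<lambda>t. s - t) has_real_derivative - 1) (at t)" for t by (auto intro!: derivative_eq_intros)
  have dU: "(U has_real_derivative V t) (at t)" for t
    unfolding U_def[abs_def] V_def
  proof (rule has_real_derivative_glue)
    show "((\<lambda>t. u (t - s)) has_real_derivative v (t - s)) (at t)" for t
      using DERIV_chain2[OF A.du dr] by simp
    show "((\<lambda>t. - x (s - t)) has_real_derivative z (s - t)) (at t)" for t
      using DERIV_minus[OF DERIV_chain2[OF B.du dl]] by simp
  qed (use m in auto)
  have dV: "(V has_real_derivative h t * (U t ^ 3 - U t)) (at t)" for t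
  proof -
    have "((\<lambda>t. if s \<le> t then v (t - s) else z (s - t)) has_real_derivative
      (if s \<le> t then h t * clamped_cubic (u (t - s)) else - (h t * clamped_cubic (x (s - t))))) (at t)"
    proof (rule has_real_derivative_glue)
      show "((\<lambda>t. v (t - s)) has_real_derivative h t * clamped_cubic (u (t - s))) (at t)" for t
        using DERIV_chain2[OF A.dv dr] by simp
      show "((\<lambda>t. z (s - t)) has_real_derivative - (h t * clamped_cubic (x (s - t)))) (at t)" for t
        using DERIV_chain2[OF B.dv dl] by simp
    qed (use m in auto)
    moreover have "(if s \<le> t then h t * clamped_cubic (u (t - s)) else - (h t * clamped_cubic (x (s - t))))
        = h t * (U t ^ 3 - U t)"
      using A.u_ge0[of "t - s"] A.u_le1[of "t - s"] B.u_ge0[of "s - t"] B.u_le1[of "s - t"]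
      by (simp add: U_def clamped_cubic_eq right_diff_distrib)
    ultimately show ?thesis by (simp add: V_def[abs_def])
  qed
  have Vpos: "0 < V t" for t using A.v_pos B.v_pos by (simp add: V_def)
  have C: "0 < C" "e \<le> (2 + 2 * b) * exp (- a * y) \<Longrightarrow> w - \<bar>s\<bar> \<le> y \<Longrightarrow> e \<le> C * exp (- a * w)" for e y w
  proof -
    show "0 < C" using ab by (simp add: C_def)
    assume e: "e \<le> (2 + 2 * b) * exp (- a * y)" and y: "w - \<bar>s\<bar> \<le> y"
    have "a * (w - \<bar>s\<bar>) \<le> a * y" using y ab by (intro mult_left_mono) auto
    hence "exp (- a * y) \<le> exp (a * \<bar>s\<bar> + - a * w)" by (simp add: algebra_simps)
    also have "\<dots> = exp (a * \<bar>s\<bar>) * exp (- a * w)" by (rule exp_add)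
    finally have "(2 + 2 * b) * exp (- a * y) \<le> (2 + 2 * b) * (exp (a * \<bar>s\<bar>) * exp (- a * w))"
      using ab by (intro mult_left_mono) auto
    with e show "e \<le> C * exp (- a * w)" by (simp add: C_def)
  qed
  have coef: "w * e \<le> (2 + 2 * b) * e" if "w \<le> 2 + 2 * b" "0 \<le> e" for w e
    using that by (rule mult_right_mono)
  show thesis
  proof (rule that[OF ab(1) C(1) dU dV Vpos])
    fix t
    have "V t \<le> 2 * b * exp (- a * \<bar>t - s\<bar>)"
      using A.v_decay[of "t - s"] B.v_decay[of "s - t"] by (auto simp: V_def a_def b_def abs_if)
    also have "\<dots> \<le> (2 + 2 * b) * exp (- a * \<bar>t - s\<bar>)" by (rule coef) auto
    finally show "V t \<le> C * exp (- a * \<bar>t\<bar>)" by (rule C(2)) linarith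
    show "\<bar>U t - 1\<bar> \<le> C * exp (- a * t)"
    proof (rule C(2))
      show "\<bar>U t - 1\<bar> \<le> (2 + 2 * b) * exp (- a * (t - s))"
      proof (cases "s \<le> t")
        case True
        hence "\<bar>U t - 1\<bar> \<le> 1 * exp (- a * (t - s))"
          using A.u_le1[of "t - s"] A.u_decay[of "t - s"] by (simp add: U_def a_def)
        also have "\<dots> \<le> (2 + 2 * b) * exp (- a * (t - s))" by (rule coef) (use ab in auto)
        finally show ?thesis .
      next
        case False
        hence "\<bar>U t - 1\<bar> \<le> 2 * 1"
          using B.u_le1[of "s - t"] B.u_ge0[of "s - t"] by (simp add: U_def)
        also have "\<dots> \<le> (2 + 2 * b) * exp (- a * (t - s))"
          using False ab by (intro mult_mono) (auto simp: mult_le_0_iff)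
        finally show ?thesis .
      qed
    qed auto
    have "\<bar>U t + 1\<bar> \<le> C * exp (- a * (- t))"
    proof (rule C(2))
      show "\<bar>U t + 1\<bar> \<le> (2 + 2 * b) * exp (- a * (s - t))"
      proof (cases "s \<le> t")
        case True
        hence "\<bar>U t + 1\<bar> \<le> 2 * 1"
          using A.u_le1[of "t - s"] A.u_ge0[of "t - s"] by (simp add: U_def)
        also have "\<dots> \<le> (2 + 2 * b) * exp (- a * (s - t))"
          using True ab by (intro mult_mono) (auto simp: mult_le_0_iff)
        finally show ?thesis .
      next
        case False
        hence "\<bar>U t + 1\<bar> \<le> 1 * exp (- a * (s - t))"
          using B.u_le1[of "s - t"] B.u_decay[of "s - t"] by (simp add: U_def a_def)
        also have "\<dots> \<le> (2 + 2 * b) * exp (- a * (s - t))" by (rule coef) (use ab in auto)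
        finally show ?thesis .
      qed
    qed auto
    thus "\<bar>U t + 1\<bar> \<le> C * exp (a * t)" by simp
  qed
qed

section \<open>Reduction of the profile equation\<close>

text \<open>The variable \<open>\<sigma> = \<integral> dx / p\<^sup>2\<close> removes the weight from \<open>(p\<^sup>2 u')'\<close>. Its slope is at least \<open>1 / M\<^sup>2\<close>, so it is a
  bijection with Lipschitz inverse, and a period of \<open>p\<close> is mapped to a period in the new variable.\<close>

lemma time_change:
  fixes p :: "real \<Rightarrow> real"
  assumes p_cont: "continuous_on UNIV p" and p: "\<And>x. 0 < p x" "\<And>x. p x \<le> M"
    and per: "\<And>x. p (x + T) = p x" and "0 < T"
  obtains \<sigma> \<tau> P where "\<And>x. (\<sigma> has_real_derivative 1 / (p x)^2) (at x)"
    "\<And>x. 0 \<le> x \<Longrightarrow> x / M^2 \<le> \<sigma> x" "\<And>x. x \<le> 0 \<Longrightarrow> \<sigma> x \<le> x / M^2"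
    "\<And>x. \<tau> (\<sigma> x) = x" "continuous_on UNIV \<tau>" "0 < P" "\<And>y. \<tau> (y + P) = \<tau> y + T"
proof -
  have M: "0 < M" using p[of 0] by linarith
  have "continuous_on UNIV (\<lambda>x. 1 / (p x)^2)"
    using p(1) by (intro continuous_intros p_cont) (simp add: less_imp_neq[symmetric])
  then obtain S where S: "\<And>x. (S has_real_derivative 1 / (p x)^2) (at x)"
    using real_antiderivative_exists by blast
  define \<sigma> where "\<sigma> x = S x - S 0" for x
  have d: "(\<sigma> has_real_derivative 1 / (p x)^2) (at x)" for x
    unfolding \<sigma>_def using DERIV_diff[OF S DERIV_const] by simp
  have slope: "(y - x) / M^2 \<le> \<sigma> y - \<sigma> x" if "x \<le> y" for x y
  proof -
    have "\<sigma> x - x / M^2 \<le> \<sigma> y - y / M^2"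
    proof (rule le_of_deriv_nonneg[where F = "\<lambda>x. \<sigma> x - x / M^2" and F' = "\<lambda>x. 1 / (p x)^2 - 1 / M^2"])
      fix x
      show "((\<lambda>x. \<sigma> x - x / M^2) has_real_derivative 1 / (p x)^2 - 1 / M^2) (at x)"
        by (rule DERIV_diff[OF d DERIV_cdivide[OF DERIV_ident]])
      have "(p x)^2 \<le> M^2" using p[of x] by (intro power_mono) auto
      thus "0 \<le> 1 / (p x)^2 - 1 / M^2" using p(1)[of x] by (simp add: frac_le)
    qed (rule that)
    thus ?thesis by (simp add: diff_divide_distrib)
  qed
  have \<sigma>0: "\<sigma> 0 = 0" by (simp add: \<sigma>_def)
  have right: "x / M^2 \<le> \<sigma> x" if "0 \<le> x" for x using slope[OF that] \<sigma>0 by simp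
  have left: "\<sigma> x \<le> x / M^2" if "x \<le> 0" for x using slope[OF that] \<sigma>0 by simp
  have "\<exists>x. \<sigma> x = y" for y
  proof -
    have "\<exists>x\<ge>- (M^2 * \<bar>y\<bar>). x \<le> M^2 * \<bar>y\<bar> \<and> \<sigma> x = y"
    proof (rule IVT)
      show "\<sigma> (- (M^2 * \<bar>y\<bar>)) \<le> y" using left[of "- (M^2 * \<bar>y\<bar>)"] M by simp
      show "y \<le> \<sigma> (M^2 * \<bar>y\<bar>)" using right[of "M^2 * \<bar>y\<bar>"] M by simp
      have "0 \<le> M^2 * \<bar>y\<bar>" by simp
      thus "- (M^2 * \<bar>y\<bar>) \<le> M^2 * \<bar>y\<bar>" by linarith
    qed (use DERIV_isCont[OF d] in auto)
    thus ?thesis by auto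
  qed
  then obtain \<tau> where \<tau>: "\<And>y. \<sigma> (\<tau> y) = y" by metis
  have dist_le: "\<bar>x - y\<bar> \<le> M^2 * \<bar>\<sigma> x - \<sigma> y\<bar>" for x y
  proof -
    have "y - x \<le> M^2 * \<bar>\<sigma> x - \<sigma> y\<bar>" if "x \<le> y" for x y
    proof -
      have "y - x \<le> M^2 * (\<sigma> y - \<sigma> x)" using slope[OF that] M by (simp add: field_simps)
      also have "\<dots> \<le> M^2 * \<bar>\<sigma> x - \<sigma> y\<bar>" by (intro mult_left_mono) auto
      finally show ?thesis .
    qed
    from this[of x y] this[of y x] show ?thesis by (cases "x \<le> y") (auto simp: abs_minus_commute)
  qed
  have inj: "x = y" if "\<sigma> x = \<sigma> y" for x y using dist_le[of x y] that by simp
  have "(M^2)-lipschitz_on UNIV \<tau>"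
    by (rule lipschitz_onI) (use dist_le[of "\<tau> _" "\<tau> _"] in \<open>auto simp: \<tau> dist_real_def\<close>)
  hence \<tau>_cont: "continuous_on UNIV \<tau>" by (rule lipschitz_on_continuous_on)
  have incr: "\<sigma> (x + T) - \<sigma> x = \<sigma> T" for x
  proof -
    have "((\<lambda>x. \<sigma> (x + T) - \<sigma> x) has_real_derivative 0) (at x)" for x
    proof -
      have "((\<lambda>x. x + T) has_real_derivative 1) (at x)" by (auto intro!: derivative_eq_intros)
      from DERIV_diff[OF DERIV_chain2[OF d this] d] show ?thesis by (simp add: per)
    qed
    from DERIV_isconst_all[of "\<lambda>x. \<sigma> (x + T) - \<sigma> x" x 0] this show ?thesis by (simp add: \<sigma>0)
  qed
  have shift: "\<sigma> (x + T) = \<sigma> x + \<sigma> T" for x using incr[of x] by linarith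
  have "\<tau> (y + \<sigma> T) = \<tau> y + T" for y by (rule inj) (simp add: \<tau> shift)
  moreover have "0 < T / M^2" using M \<open>0 < T\<close> by simp
  hence "0 < \<sigma> T" using right[of T] \<open>0 < T\<close> by linarith
  ultimately show thesis using that[OF d right left inj[OF \<tau>] \<tau>_cont] by blast
qed

text \<open>An interpolation bound: on each unit interval the derivative takes a mean value of size at most \<open>M\<close>, and it varies by at
most \<open>K\<close> from there.\<close>

lemma bounded_first_derivative:
  fixes p :: "real \<Rightarrow> real"
  assumes "\<And>x. (p has_real_derivative p' x) (at x)" "\<And>x. (p' has_real_derivative p'' x) (at x)"
    and "\<And>x. 0 < p x" "\<And>x. p x \<le> M" "\<And>x. \<bar>p'' x\<bar> \<le> K"
  shows "\<bar>p' x\<bar> \<le> M + K"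
proof -
  obtain y where y: "x < y" "y < x + 1" "p (x + 1) - p x = (x + 1 - x) * p' y"
    using MVT2[of x "x + 1" p p'] assms(1) by auto
  obtain w where w: "p' y - p' x = (y - x) * p'' w"
    using MVT2[of x y p' p''] assms(2) y by auto
  have "\<bar>(y - x) * p'' w\<bar> \<le> 1 * K" unfolding abs_mult
    using y assms(5)[of w] by (intro mult_mono) auto
  moreover have "\<bar>p' y\<bar> \<le> M" using y(3) assms(3)[of x] assms(3)[of "x + 1"] assms(4)[of x] assms(4)[of "x + 1"]
    by simp
  ultimately show ?thesis using w by linarith
qed

theorem theorem0p1:
  fixes T lam gmin gmax :: real
    and g \<phi>p \<phi>m :: "real \<Rightarrow> real"
  assumes "T > 0" and "lam < 0"
    and "continuous_on UNIV g" and "periodic_fun_simple g T"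
    and "0 < gmin" and "\<And>x. gmin \<le> g x \<and> g x \<le> gmax"
    and "profile_solution lam g \<phi>p" and "periodic_fun_simple \<phi>p T"
    and "\<And>x. sqrt (- lam / gmax) < \<phi>p x \<and> \<phi>p x < sqrt (- lam / gmin)"
    and "\<phi>m = (\<lambda>x. - \<phi>p x)"
  shows "\<exists>\<phi>. profile_solution lam g \<phi>
           \<and> ((\<lambda>x. \<phi> x / \<phi>p x) \<longlongrightarrow> 1) at_top
           \<and> ((\<lambda>x. \<phi> x / \<phi>m x) \<longlongrightarrow> 1) at_bot
           \<and> (\<forall>x. deriv (\<lambda>y. \<phi> y / \<phi>p y) x > 0)
           \<and> (\<exists>C0>0. \<exists>C>0.
                 exp_decay_C1_on {0<..} C C0 (\<lambda>x. \<phi> x - \<phi>p x)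
               \<and> exp_decay_C1_on {..<0} C C0 (\<lambda>x. \<phi> x - \<phi>m x))"
proof -
  define L M where "L = sqrt (- lam / gmax)" and "M = sqrt (- lam / gmin)"
  define p' where "p' = deriv \<phi>p"
  define p'' where "p'' x = 2 * lam * \<phi>p x + 2 * g x * \<phi>p x ^ 3" for x
  have g: "gmin \<le> g x" "g x \<le> gmax" "0 < g x" for x using assms(5) assms(6)[of x] by auto
  have gmax: "0 < gmax" using g[of 0] by linarith
  have L: "0 < L" using \<open>lam < 0\<close> gmax by (simp add: L_def divide_neg_pos)
  have pL: "L \<le> \<phi>p x" and pM: "\<phi>p x \<le> M" for x
    using assms(9)[of x] by (simp_all add: L_def M_def)
  have p0: "0 < \<phi>p x" for x using pL[of x] L by linarith
  have M: "0 < M" using p0[of 0] pM[of 0] by linarith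
  have per: "\<phi>p (x + T) = \<phi>p x" "g (x + T) = g x" for x
    using assms(4,8) by (simp_all add: periodic_fun_simple_def)
  have dp: "(\<phi>p has_real_derivative p' x) (at x)" and dp': "(p' has_real_derivative p'' x) (at x)" for x
  proof -
    have *: "\<phi>p differentiable (at x)" "deriv \<phi>p differentiable (at x)"
      "- (1 / 2) * deriv (deriv \<phi>p) x + lam * \<phi>p x + g x * \<phi>p x ^ 3 = 0"
      using assms(7) by (auto simp: profile_solution_def)
    show "(\<phi>p has_real_derivative p' x) (at x)"
      using *(1) by (simp add: p'_def DERIV_deriv_iff_real_differentiable)
    have "deriv p' x = p'' x" using *(3) by (simp add: p'_def p''_def)
    thus "(p' has_real_derivative p'' x) (at x)"
      using *(2) by (metis p'_def DERIV_deriv_iff_real_differentiable)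
  qed
  have p_cont: "continuous_on UNIV \<phi>p"
    using dp by (meson DERIV_isCont continuous_at_imp_continuous_on)
  obtain \<sigma> \<tau> P where \<sigma>: "\<And>x. (\<sigma> has_real_derivative 1 / (\<phi>p x)^2) (at x)"
      "\<And>x. 0 \<le> x \<Longrightarrow> x / M^2 \<le> \<sigma> x" "\<And>x. x \<le> 0 \<Longrightarrow> \<sigma> x \<le> x / M^2"
    and \<tau>: "\<And>x. \<tau> (\<sigma> x) = x" "continuous_on UNIV \<tau>" "0 < P" "\<And>y. \<tau> (y + P) = \<tau> y + T"
    by (rule time_change[OF p_cont p0 pM per(1) \<open>0 < T\<close>], rule that)
  \<comment> \<open>\<open>(p\<^sup>2 u')' = 2 g p\<^sup>4 (u\<^sup>3 - u)\<close> multiplied by \<open>p\<^sup>2 = dx/d\<sigma>\<close>, hence the sixth power.\<close>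
  define h where "h y = 2 * g (\<tau> y) * \<phi>p (\<tau> y) ^ 6" for y
  interpret periodic_pinched h "2 * gmin * L^6" "2 * gmax * M^6" P
  proof
    have "continuous_on UNIV (\<lambda>x. 2 * g x * \<phi>p x ^ 6)"
      by (intro continuous_intros p_cont assms(3))
    from continuous_on_compose2[OF this \<tau>(2)] show "continuous_on UNIV h" by (simp add: h_def[abs_def])
    show "0 < 2 * gmin * L^6" using L assms(5) by simp
    fix t
    have "L^6 \<le> \<phi>p (\<tau> t) ^ 6" "\<phi>p (\<tau> t) ^ 6 \<le> M^6"
      using pL[of "\<tau> t"] pM[of "\<tau> t"] p0[of "\<tau> t"] L by (auto intro: power_mono)
    thus "2 * gmin * L^6 \<le> h t" "h t \<le> 2 * gmax * M^6"
      unfolding h_def using g[of "\<tau> t"] gmax assms(5) L p0[of "\<tau> t"] by (auto intro!: mult_mono)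
    show "h (t + P) = h t" by (simp add: h_def \<tau>(4) per)
  qed (rule \<tau>(3))
  obtain U V C c where c: "0 < c" and C: "0 < C"
    and dU: "\<And>t. (U has_real_derivative V t) (at t)"
    and dV: "\<And>t. (V has_real_derivative h t * (U t ^ 3 - U t)) (at t)"
    and V: "\<And>t. 0 < V t" "\<And>t. V t \<le> C * exp (- c * \<bar>t\<bar>)"
    and U: "\<And>t. \<bar>U t - 1\<bar> \<le> C * exp (- c * t)" "\<And>t. \<bar>U t + 1\<bar> \<le> C * exp (c * t)"
    by (rule heteroclinic_exists, rule that)
  have U_top: "(U \<longlongrightarrow> 1) at_top"
  proof (rule LIM_zero_cancel, rule Lim_null_comparison)
    have "filterlim (\<lambda>t. - c * t) at_bot at_top"
      using c by (intro filterlim_tendsto_neg_mult_at_bot[OF tendsto_const] filterlim_ident) auto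
    from filterlim_compose[OF exp_at_bot this]
    show "((\<lambda>t. C * exp (- c * t)) \<longlongrightarrow> 0) at_top" by (rule tendsto_mult_right_zero)
  qed (use U in auto)
  have U_bot: "(U \<longlongrightarrow> - 1) at_bot"
  proof (rule LIM_zero_cancel, rule Lim_null_comparison)
    have "filterlim (\<lambda>t. c * t) at_bot at_bot"
      using c by (intro filterlim_tendsto_pos_mult_at_bot[OF tendsto_const] filterlim_ident) auto
    from filterlim_compose[OF exp_at_bot this]
    show "((\<lambda>t. C * exp (c * t)) \<longlongrightarrow> 0) at_bot" by (rule tendsto_mult_right_zero)
  qed (use U in auto)
  have \<sigma>_top: "filterlim \<sigma> at_top at_top"
  proof (rule filterlim_at_top_mono)
    show "filterlim (\<lambda>x. 1 / M^2 * x) at_top at_top"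
      using M by (intro filterlim_tendsto_pos_mult_at_top[OF tendsto_const] filterlim_ident) auto
    show "eventually (\<lambda>x. 1 / M^2 * x \<le> \<sigma> x) at_top"
      using eventually_ge_at_top[of 0] by eventually_elim (use \<sigma>(2) in auto)
  qed
  have \<sigma>_bot: "filterlim \<sigma> at_bot at_bot"
  proof (rule filterlim_at_bot_mono)
    show "filterlim (\<lambda>x. 1 / M^2 * x) at_bot at_bot"
      using M by (intro filterlim_tendsto_pos_mult_at_bot[OF tendsto_const] filterlim_ident) auto
    show "eventually (\<lambda>x. \<sigma> x \<le> 1 / M^2 * x) at_bot"
      using eventually_le_at_bot[of 0] by eventually_elim (use \<sigma>(3) in auto)
  qed
  define \<phi> where "\<phi> x = \<phi>p x * U (\<sigma> x)" for x
  define \<phi>' where "\<phi>' x = p' x * U (\<sigma> x) + V (\<sigma> x) / \<phi>p x" for x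
  have dU\<sigma>: "((\<lambda>x. U (\<sigma> x)) has_real_derivative V (\<sigma> x) * (1 / (\<phi>p x)^2)) (at x)"
    and dV\<sigma>: "((\<lambda>x. V (\<sigma> x)) has_real_derivative h (\<sigma> x) * (U (\<sigma> x) ^ 3 - U (\<sigma> x)) * (1 / (\<phi>p x)^2)) (at x)" for x
    by (rule DERIV_chain2[OF dU \<sigma>(1)] DERIV_chain2[OF dV \<sigma>(1)])+
  have d\<phi>: "(\<phi> has_real_derivative \<phi>' x) (at x)" for x
    unfolding \<phi>_def[abs_def] \<phi>'_def using p0[of x]
    by (auto intro!: derivative_eq_intros dp dU\<sigma> simp: field_simps power2_eq_square)
  have h_\<sigma>: "h (\<sigma> x) = 2 * g x * \<phi>p x ^ 6" for x by (simp add: h_def \<tau>)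
  have d\<phi>': "(\<phi>' has_real_derivative 2 * lam * \<phi> x + 2 * g x * \<phi> x ^ 3) (at x)" for x
  proof -
    define q w y where "q = \<phi>p x" and "w = U (\<sigma> x)" and "y = V (\<sigma> x)"
    have q: "q \<noteq> 0" using p0[of x] by (simp add: q_def)
    have "(\<phi>' has_real_derivative p'' x * w + y * (1 / q^2) * p' x
        + (h (\<sigma> x) * (w^3 - w) * (1 / q^2) * q - y * p' x) / (q * q)) (at x)"
      unfolding \<phi>'_def[abs_def] q_def w_def y_def
      by (intro DERIV_add DERIV_mult DERIV_divide dp dp' dU\<sigma> dV\<sigma>) (use p0[of x] in auto)
    moreover have "h (\<sigma> x) * (w^3 - w) * (1 / q^2) * q = 2 * g x * q^3 * (w^3 - w) * (q * q)"
      using q by (simp add: h_\<sigma> q_def[symmetric] eval_nat_numeral)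
    moreover have "p'' x * w = 2 * lam * (q * w) + 2 * g x * q^3 * w"
      by (simp add: p''_def q_def[symmetric] algebra_simps)
    ultimately have "(\<phi>' has_real_derivative 2 * lam * (q * w) + 2 * g x * q^3 * w
        + y * (1 / q^2) * p' x + (2 * g x * q^3 * (w^3 - w) * (q * q) - y * p' x) / (q * q)) (at x)"
      by simp
    moreover have "(2 * g x * q^3 * (w^3 - w) * (q * q) - y * p' x) / (q * q)
        = 2 * g x * q^3 * (w^3 - w) - y * (1 / q^2) * p' x"
      using q by (simp add: diff_divide_distrib power2_eq_square)
    ultimately have "(\<phi>' has_real_derivative 2 * lam * (q * w) + 2 * g x * q^3 * w
        + y * (1 / q^2) * p' x + (2 * g x * q^3 * (w^3 - w) - y * (1 / q^2) * p' x)) (at x)"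
      by simp
    moreover have "2 * lam * (q * w) + 2 * g x * q^3 * w + y * (1 / q^2) * p' x
        + (2 * g x * q^3 * (w^3 - w) - y * (1 / q^2) * p' x)
      = 2 * lam * (q * w) + 2 * g x * (q * w) ^ 3"
      by (simp add: power_mult_distrib algebra_simps)
    ultimately show ?thesis by (simp only: \<phi>_def q_def w_def)
  qed
  have deriv_\<phi>: "deriv \<phi> = \<phi>'" by (intro ext DERIV_imp_deriv d\<phi>)
  have solution: "profile_solution lam g \<phi>"
    unfolding profile_solution_def deriv_\<phi>
  proof (intro allI conjI)
    fix x
    show "\<phi> differentiable (at x)" "\<phi>' differentiable (at x)"
      using d\<phi> d\<phi>' by (auto simp: real_differentiable_def)
    show "- (1 / 2) * deriv \<phi>' x + lam * \<phi> x + g x * \<phi> x ^ 3 = 0"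
      by (simp add: DERIV_imp_deriv[OF d\<phi>'] algebra_simps)
  qed
  have quot: "\<phi> x / \<phi>p x = U (\<sigma> x)" for x using p0[of x] by (simp add: \<phi>_def)
  have lim_top: "((\<lambda>x. \<phi> x / \<phi>p x) \<longlongrightarrow> 1) at_top"
    unfolding quot by (rule filterlim_compose[OF U_top \<sigma>_top])
  have "((\<lambda>x. - U (\<sigma> x)) \<longlongrightarrow> - (- 1)) at_bot"
    by (intro tendsto_minus filterlim_compose[OF U_bot \<sigma>_bot])
  hence lim_bot: "((\<lambda>x. \<phi> x / \<phi>m x) \<longlongrightarrow> 1) at_bot" by (simp add: assms(10) quot)
  have mono: "0 < deriv (\<lambda>y. \<phi> y / \<phi>p y) x" for x
    unfolding quot DERIV_imp_deriv[OF dU\<sigma>] using V(1) p0[of x] by simp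
  define K where "K = M + (2 * \<bar>lam\<bar> * M + 2 * gmax * M^3)"
  have p'_le: "\<bar>p' x\<bar> \<le> K" for x
    unfolding K_def
  proof (rule bounded_first_derivative[OF dp dp' p0 pM])
    fix x
    have "\<bar>2 * lam * \<phi>p x\<bar> \<le> 2 * \<bar>lam\<bar> * M"
      using pM[of x] p0[of x] by (auto simp: abs_mult intro!: mult_mono)
    moreover have "\<bar>2 * g x * \<phi>p x ^ 3\<bar> \<le> 2 * gmax * M^3"
      using pM[of x] p0[of x] g[of x] by (auto simp: abs_mult power_abs intro!: mult_mono power_mono)
    ultimately show "\<bar>p'' x\<bar> \<le> 2 * \<bar>lam\<bar> * M + 2 * gmax * M^3"
      unfolding p''_def using abs_triangle_ineq[of "2 * lam * \<phi>p x" "2 * g x * \<phi>p x ^ 3"] by linarith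
  qed
  have K: "0 \<le> K" using p'_le[of 0] by linarith
  define D where "D = (M + K + 1 / L) * C"
  have D: "0 < D" unfolding D_def using M K L C by (intro mult_pos_pos) (auto intro: add_pos_pos add_pos_nonneg)
  have estimate: "\<bar>\<phi> x - \<epsilon> * \<phi>p x\<bar> + \<bar>\<phi>' x - \<epsilon> * p' x\<bar> \<le> D * exp (- (c / M^2) * \<bar>x\<bar>)"
    if w: "\<bar>U (\<sigma> x) - \<epsilon>\<bar> \<le> C * exp (- c * \<bar>\<sigma> x\<bar>)" and far: "\<bar>x\<bar> / M^2 \<le> \<bar>\<sigma> x\<bar>" for x \<epsilon>
  proof -
    define E where "E = C * exp (- c * \<bar>\<sigma> x\<bar>)"
    have E: "0 \<le> E" using C by (simp add: E_def)
    have "\<phi> x - \<epsilon> * \<phi>p x = \<phi>p x * (U (\<sigma> x) - \<epsilon>)" by (simp add: \<phi>_def algebra_simps)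
    hence "\<bar>\<phi> x - \<epsilon> * \<phi>p x\<bar> = \<phi>p x * \<bar>U (\<sigma> x) - \<epsilon>\<bar>"
      using p0[of x] by (simp add: abs_mult)
    also have "\<dots> \<le> M * E" using w p0[of x] pM[of x] E by (intro mult_mono) (auto simp: E_def)
    finally have 1: "\<bar>\<phi> x - \<epsilon> * \<phi>p x\<bar> \<le> M * E" .
    have "\<phi>' x - \<epsilon> * p' x = p' x * (U (\<sigma> x) - \<epsilon>) + V (\<sigma> x) / \<phi>p x"
      by (simp add: \<phi>'_def algebra_simps)
    also have "\<bar>\<dots>\<bar> \<le> \<bar>p' x\<bar> * \<bar>U (\<sigma> x) - \<epsilon>\<bar> + V (\<sigma> x) / \<phi>p x"
      using V(1)[of "\<sigma> x"] p0[of x] by (intro order.trans[OF abs_triangle_ineq]) (simp add: abs_mult)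
    also have "\<dots> \<le> K * E + E / L"
      using w p'_le[of x] K V(2)[of "\<sigma> x"] V(1)[of "\<sigma> x"] pL[of x] L E
      by (intro add_mono mult_mono frac_le) (auto simp: E_def)
    finally have "\<bar>\<phi> x - \<epsilon> * \<phi>p x\<bar> + \<bar>\<phi>' x - \<epsilon> * p' x\<bar> \<le> M * E + (K * E + E / L)" using 1 by linarith
    also have "\<dots> = D * exp (- c * \<bar>\<sigma> x\<bar>)" by (simp add: D_def E_def algebra_simps)
    also have "\<dots> \<le> D * exp (- (c / M^2) * \<bar>x\<bar>)"
      using D mult_left_mono[OF far, of c] c by (intro mult_left_mono) auto
    finally show ?thesis .
  qed
  have "exp_decay_C1_on {0<..} D (c / M^2) (\<lambda>x. \<phi> x - \<phi>p x)"
    unfolding exp_decay_C1_on_def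
  proof
    fix x :: real assume "x \<in> {0<..}"
    hence x: "0 < x" by simp
    have "0 < x / M^2" using x M by simp
    hence \<sigma>x: "x / M^2 \<le> \<sigma> x" "0 < \<sigma> x" using \<sigma>(2)[of x] x by linarith+
    have "deriv (\<lambda>x. \<phi> x - \<phi>p x) x = \<phi>' x - p' x" by (intro DERIV_imp_deriv DERIV_diff d\<phi> dp)
    thus "\<bar>\<phi> x - \<phi>p x\<bar> + \<bar>deriv (\<lambda>x. \<phi> x - \<phi>p x) x\<bar> \<le> D * exp (- (c / M^2) * \<bar>x\<bar>)"
      using estimate[of x 1] U(1)[of "\<sigma> x"] \<sigma>x x by simp
  qed
  moreover have "exp_decay_C1_on {..<0} D (c / M^2) (\<lambda>x. \<phi> x - \<phi>m x)"
    unfolding exp_decay_C1_on_def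
  proof
    fix x :: real assume "x \<in> {..<0}"
    hence x: "x < 0" by simp
    have "x / M^2 < 0" using x M by (simp add: divide_neg_pos)
    hence \<sigma>x: "\<sigma> x \<le> x / M^2" "\<sigma> x < 0" using \<sigma>(3)[of x] x by linarith+
    have "deriv (\<lambda>x. \<phi> x - \<phi>m x) x = \<phi>' x - - p' x"
      unfolding assms(10) by (intro DERIV_imp_deriv DERIV_diff DERIV_minus d\<phi> dp)
    thus "\<bar>\<phi> x - \<phi>m x\<bar> + \<bar>deriv (\<lambda>x. \<phi> x - \<phi>m x) x\<bar> \<le> D * exp (- (c / M^2) * \<bar>x\<bar>)"
      using estimate[of x "- 1"] U(2)[of "\<sigma> x"] \<sigma>x x by (simp add: assms(10))
  qed
  moreover have "0 < c / M^2" using c M by simp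
  ultimately show ?thesis using solution lim_top lim_bot mono D by blast
qed

end
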